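(* For each of the following four relations between extended real numbers $\underline{C},\underline{A},\overline{A},\overline{C}$: (1) $\underline{C}<\underline{A}<\overline{A}<\overline{C}$; (2) $\underline{C}=\underline{A}<\overline{A}=\overline{C}$; (3) $\underline{C}<\underline{A}<\overline{A}=\overline{C}$; (4) $\underline{C}=\underline{A}<\overline{A}<\overline{C}$; there exist a Markov Decision Process with a countably infinite state space, a state $x$, and a stationary policy $\phi$ such that the relation holds both with $\underline{C}=w_*(x,\phi)$, $\underline{A}=\underline{w}(x,\phi)$, $\overline{A}=\overline{w}(x,\phi)$, $\overline{C}=w^*(x,\phi)$ and with $\underline{C}=w_*(x)$, $\underline{A}=\underline{w}(x)$, $\overline{A}=\overline{w}(x)$, $\overline{C}=w^*(x)$. In particular, for Markov Decision Processes with countably infinite state spaces, $w^*(x)=\overline{w}(x)$ does not imply $w_*(x)=\underline{w}(x)$, and $w_*(x)=\underline{w}(x)$ does not imply $w^*(x)=\overline{w}(x)$.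
   Context: A Markov Decision Process (MDP) consists of: a nonempty countable (finite or countably infinite) state space $\mathbb{X}$; a measurable action space $(\mathbb{A},\mathcal{A})$ in which all singletons are measurable; for each $x\in\mathbb{X}$ a nonempty set of available actions $A(x)\in\mathcal{A}$; transition probabilities $p(y|x,a)$ ($x,y\in\mathbb{X}$, $a\in A(x)$), where $p(\cdot|x,a)$ is a probability mass function on $\mathbb{X}$ and $p(y|x,\cdot)$ is measurable on $A(x)$; and one-step costs $c(x,a)$ ($x\in\mathbb{X}$, $a\in A(x)$) that are real, uniformly bounded below, with $c(x,\cdot)$ measurable on $A(x)$. Let $\mathbb{H}_n=\mathbb{X}\times(\mathbb{A}\times\mathbb{X})^n$, $n=0,1,\ldots$, with the product sigma-field $\mathcal{F}_n$ (all subsets on $\mathbb{X}$, $\mathcal{A}$ on $\mathbb{A}$). A policy $\pi=\{\pi_n\}_{n=0,1,\ldots}$ is a sequence of transition probabilities from $\mathbb{H}_n$ to $\mathbb{A}$: for each $h_n=x_0a_0x_1\ldots a_{n-1}x_n\in\mathbb{H}_n$, $\pi_n(\cdot|h_n)$ is a probability on $(\mathbb{A},\mathcal{A})$ with $\pi_n(A(x_n)|h_n)=1$, and $\pi_n(B|\cdot)$ is $\mathcal{F}_n$-measurable for each $B\in\mathcal{A}$. A policy is stationary if there is a mapping $\phi:\mathbb{X}\to\mathbb{A}$ with $\phi(x)\in A(x)$ for all $x$ and $\pi_n(\{\phi(x_n)\}|h_n)=1$ for all $n$ and $h_n$; such a policy is denoted by $\phi$. Let $\Pi$ be the set of all policies.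 An initial state $x$ and a policy $\pi$ define (by the Ionescu Tulcea theorem) a probability measure on trajectories $x_0a_0x_1a_1\ldots$ with $x_0=x$; $\mathbb{E}_x^\pi$ denotes its expectation. For $\alpha\in[0,1)$ let $v_\alpha(x,\pi)=\mathbb{E}_x^\pi\sum_{n=0}^\infty\alpha^n c(x_n,a_n)$. Define $$w^*(x,\pi)=\limsup_{N\to\infty}\frac1N\mathbb{E}_x^\pi\sum_{n=0}^{N-1}c(x_n,a_n),\qquad w_*(x,\pi)=\liminf_{N\to\infty}\frac1N\mathbb{E}_x^\pi\sum_{n=0}^{N-1}c(x_n,a_n),$$ $$\overline{w}(x,\pi)=\limsup_{\alpha\to1-}(1-\alpha)v_\alpha(x,\pi),\qquad \underline{w}(x,\pi)=\liminf_{\alpha\to1-}(1-\alpha)v_\alpha(x,\pi).$$ For each $g\in\{w^*,w_*,\overline{w},\underline{w}\}$, the corresponding value function is $g(x)=\inf_{\pi\in\Pi}g(x,\pi)$. *)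

theory Defs
  imports "HOL-Probability.Probability"
begin

(* Of the measure action_space only the underlying measurable space matters.
   avail x, tprob x a and cost x a are meaningful only for x in states and a in avail x. *)
record ('x, 'a) mdp =
  states :: "'x set"
  action_space :: "'a measure"
  avail :: "'x \<Rightarrow> 'a set"
  tprob :: "'x \<Rightarrow> 'a \<Rightarrow> 'x pmf"
  cost :: "'x \<Rightarrow> 'a \<Rightarrow> real"

definition is_mdp :: "('x, 'a) mdp \<Rightarrow> bool" where
  "is_mdp M \<longleftrightarrow>
     states M \<noteq> {} \<and> countable (states M) \<and>
     (\<forall>a\<in>space (action_space M). {a} \<in> sets (action_space M)) \<and>
     (\<forall>x\<in>states M. avail M x \<noteq> {} \<and> avail M x \<in> sets (action_space M)) \<and>
     (\<forall>x\<in>states M. \<forall>a\<in>avail M x. set_pmf (tprob M x a) \<subseteq> states M) \<and>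
     (\<forall>x\<in>states M. \<forall>y\<in>states M.
        (\<lambda>a. pmf (tprob M x a) y) \<in> borel_measurable (restrict_space (action_space M) (avail M x))) \<and>
     (\<forall>x\<in>states M. cost M x \<in> borel_measurable (restrict_space (action_space M) (avail M x))) \<and>
     (\<exists>K. \<forall>x\<in>states M. \<forall>a\<in>avail M x. K \<le> cost M x a)"

definition sa_space :: "('x, 'a) mdp \<Rightarrow> ('x \<times> 'a) measure" where
  "sa_space M = count_space (states M) \<Otimes>\<^sub>M action_space M"

(* X \<times> (A \<times> X)^n, re-bracketed as (X \<times> A)^n \<times> X: the history x_0 a_0 x_1 ... a_{n-1} x_n is the pair
   consisting of the sequence (x_0, a_0), ..., (x_{n-1}, a_{n-1}) and the current state x_n. *)
definition history_space :: "('x, 'a) mdp \<Rightarrow> nat \<Rightarrow> ((nat \<Rightarrow> 'x \<times> 'a) \<times> 'x) measure" where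
  "history_space M n = (\<Pi>\<^sub>M i\<in>{0..<n}. sa_space M) \<Otimes>\<^sub>M count_space (states M)"

type_synonym ('x, 'a) policy = "nat \<Rightarrow> (nat \<Rightarrow> 'x \<times> 'a) \<times> 'x \<Rightarrow> 'a measure"

definition policies :: "('x, 'a) mdp \<Rightarrow> ('x, 'a) policy set" where
  "policies M = {\<pi>. \<forall>n.
     \<pi> n \<in> history_space M n \<rightarrow>\<^sub>M prob_algebra (action_space M) \<and>
     (\<forall>h\<in>space (history_space M n). emeasure (\<pi> n h) (avail M (snd h)) = 1)}"

definition stationary :: "('x, 'a) mdp \<Rightarrow> ('x, 'a) policy \<Rightarrow> bool" where
  "stationary M \<pi> \<longleftrightarrow> \<pi> \<in> policies M \<and>
     (\<exists>\<phi>. (\<forall>x\<in>states M. \<phi> x \<in> avail M x) \<and>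
          (\<forall>n. \<forall>h\<in>space (history_space M n). emeasure (\<pi> n h) {\<phi> (snd h)} = 1))"

(* The Ionescu Tulcea construction needs kernels on the whole of X \<times> A, whereas p and c are given
   only on the pairs (x, a) with a \<in> A(x). The values chosen here for the other pairs are
   immaterial: under every policy the trajectory avoids those pairs almost surely. *)
definition trans_measure :: "('x, 'a) mdp \<Rightarrow> 'x \<times> 'a \<Rightarrow> 'x measure" where
  "trans_measure M = (\<lambda>(x, a).
     if a \<in> avail M x then density (count_space (states M)) (\<lambda>y. ennreal (pmf (tprob M x a) y))
     else return (count_space (states M)) x)"

definition step_cost :: "('x, 'a) mdp \<Rightarrow> 'x \<times> 'a \<Rightarrow> real" where
  "step_cost M = (\<lambda>(x, a). if a \<in> avail M x then cost M x a else 0)"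

definition act_kernel ::
  "('x, 'a) mdp \<Rightarrow> ('x, 'a) policy \<Rightarrow> nat \<Rightarrow> (nat \<Rightarrow> 'x \<times> 'a) \<Rightarrow> 'x \<Rightarrow> ('x \<times> 'a) measure" where
  "act_kernel M \<pi> n \<omega> y = distr (\<pi> n (\<omega>, y)) (sa_space M) (\<lambda>a. (y, a))"

fun step_kernel ::
  "('x, 'a) mdp \<Rightarrow> 'x \<Rightarrow> ('x, 'a) policy \<Rightarrow> nat \<Rightarrow> (nat \<Rightarrow> 'x \<times> 'a) \<Rightarrow> ('x \<times> 'a) measure" where
  "step_kernel M x \<pi> 0 \<omega> = act_kernel M \<pi> 0 \<omega> x"
| "step_kernel M x \<pi> (Suc n) \<omega> = trans_measure M (\<omega> n) \<bind> act_kernel M \<pi> (Suc n) \<omega>"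

(* The law of the trajectory \<omega> with \<omega> n = (x_n, a_n). The constant below is what the locale
   Ionescu_Tulcea calls PF.lim; Ionescu_Tulcea_step_kernel verifies the locale assumptions. *)
definition traj_measure ::
  "('x, 'a) mdp \<Rightarrow> 'x \<Rightarrow> ('x, 'a) policy \<Rightarrow> (nat \<Rightarrow> 'x \<times> 'a) measure" where
  "traj_measure M x \<pi> =
     projective_family.lim UNIV
       (Ionescu_Tulcea.CI (step_kernel M x \<pi>) (\<lambda>_. sa_space M)) (\<lambda>_. sa_space M)"

(* Costs are unbounded above, so expectations are extended reals, E f = E f\<^sup>+ - E f\<^sup>-;
   e2ennreal maps negative numbers to 0. Wherever this is used E f\<^sup>- is finite. *)
definition ereal_expectation :: "'b measure \<Rightarrow> ('b \<Rightarrow> ereal) \<Rightarrow> ereal" where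
  "ereal_expectation N f =
     enn2ereal (\<integral>\<^sup>+\<omega>. e2ennreal (f \<omega>) \<partial>N) - enn2ereal (\<integral>\<^sup>+\<omega>. e2ennreal (- f \<omega>) \<partial>N)"

definition discounted_cost :: "('x, 'a) mdp \<Rightarrow> real \<Rightarrow> 'x \<Rightarrow> ('x, 'a) policy \<Rightarrow> ereal" where
  "discounted_cost M \<alpha> x \<pi> =
     ereal_expectation (traj_measure M x \<pi>) (\<lambda>\<omega>. \<Sum>n. ereal (\<alpha> ^ n * step_cost M (\<omega> n)))"

definition average_cost :: "('x, 'a) mdp \<Rightarrow> nat \<Rightarrow> 'x \<Rightarrow> ('x, 'a) policy \<Rightarrow> ereal" where
  "average_cost M N x \<pi> =
     ereal (1 / real N) *
     ereal_expectation (traj_measure M x \<pi>) (\<lambda>\<omega>. ereal (\<Sum>n<N. step_cost M (\<omega> n)))"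

definition cesaro_upper :: "('x, 'a) mdp \<Rightarrow> 'x \<Rightarrow> ('x, 'a) policy \<Rightarrow> ereal" where
  "cesaro_upper M x \<pi> = limsup (\<lambda>N. average_cost M N x \<pi>)"

definition cesaro_lower :: "('x, 'a) mdp \<Rightarrow> 'x \<Rightarrow> ('x, 'a) policy \<Rightarrow> ereal" where
  "cesaro_lower M x \<pi> = liminf (\<lambda>N. average_cost M N x \<pi>)"

definition abel_upper :: "('x, 'a) mdp \<Rightarrow> 'x \<Rightarrow> ('x, 'a) policy \<Rightarrow> ereal" where
  "abel_upper M x \<pi> = Limsup (at_left 1) (\<lambda>\<alpha>. ereal (1 - \<alpha>) * discounted_cost M \<alpha> x \<pi>)"

definition abel_lower :: "('x, 'a) mdp \<Rightarrow> 'x \<Rightarrow> ('x, 'a) policy \<Rightarrow> ereal" where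
  "abel_lower M x \<pi> = Liminf (at_left 1) (\<lambda>\<alpha>. ereal (1 - \<alpha>) * discounted_cost M \<alpha> x \<pi>)"

definition optimal_value ::
  "(('x, 'a) mdp \<Rightarrow> 'x \<Rightarrow> ('x, 'a) policy \<Rightarrow> ereal) \<Rightarrow> ('x, 'a) mdp \<Rightarrow> 'x \<Rightarrow> ereal" where
  "optimal_value g M x = (INF \<pi>\<in>policies M. g M x \<pi>)"

lemma trans_measure_measurable:
  assumes M: "is_mdp M"
  shows "trans_measure M \<in> sa_space M \<rightarrow>\<^sub>M prob_algebra (count_space (states M))"
proof -
  let ?X = "count_space (states M)"
  have cX: "countable (states M)" using M by (auto simp: is_mdp_def)
  have row: "(\<lambda>a. trans_measure M (x, a)) \<in> action_space M \<rightarrow>\<^sub>M prob_algebra ?X"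
    if x: "x \<in> states M" for x
  proof -
    let ?D = "\<lambda>a. density ?X (\<lambda>y. ennreal (pmf (tprob M x a) y))"
    have av: "avail M x \<in> sets (action_space M)" using M x by (auto simp: is_mdp_def)
    have pr: "prob_space (?D a)" if a: "a \<in> avail M x" for a
    proof
      have sub: "set_pmf (tprob M x a) \<subseteq> states M" using M x a by (auto simp: is_mdp_def)
      have "emeasure (?D a) (space (?D a)) = (\<integral>\<^sup>+y. ennreal (pmf (tprob M x a) y) \<partial>?X)"
        by (subst emeasure_density) (auto intro!: nn_integral_cong)
      also have "\<dots> = emeasure (measure_pmf (tprob M x a)) (states M)"
        by (rule nn_integral_pmf)
      also have "\<dots> = 1"
        using sub by (intro measure_pmf.emeasure_eq_1_AE) (auto simp: AE_measure_pmf_iff)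
      finally show "emeasure (?D a) (space (?D a)) = 1" .
    qed
    have D: "?D \<in> restrict_space (action_space M) (avail M x) \<rightarrow>\<^sub>M prob_algebra ?X"
    proof (rule measurable_prob_algebraI)
      show "prob_space (?D a)" if "a \<in> space (restrict_space (action_space M) (avail M x))" for a
        using that pr by (auto simp: space_restrict_space)
      show "?D \<in> restrict_space (action_space M) (avail M x) \<rightarrow>\<^sub>M subprob_algebra ?X"
      proof (rule measurable_subprob_algebra)
        fix a assume "a \<in> space (restrict_space (action_space M) (avail M x))"
        then show "subprob_space (?D a)"
          using pr by (auto simp: space_restrict_space intro: prob_space_imp_subprob_space)
        show "sets (?D a) = sets ?X" by simp
      next
        fix B assume B: "B \<in> sets ?X"
        have "(\<lambda>a. \<integral>\<^sup>+y. ennreal (pmf (tprob M x a) y) \<partial>count_space B)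
          \<in> borel_measurable (restrict_space (action_space M) (avail M x))"
        proof (rule sigma_finite_measure.borel_measurable_nn_integral)
          show "sigma_finite_measure (count_space B)"
            using B cX by (auto intro!: sigma_finite_measure_count_space_countable intro: countable_subset)
          have "(\<lambda>(y, a). ennreal (pmf (tprob M x a) y)) \<in>
            borel_measurable (count_space B \<Otimes>\<^sub>M restrict_space (action_space M) (avail M x))"
          proof (rule measurable_pair_measure_countable1, goal_cases)
            case 1
            then show ?case using B cX by (auto intro: countable_subset)
          next
            case (2 y)
            then have "y \<in> states M" using B by auto
            then have "(\<lambda>a. pmf (tprob M x a) y)
              \<in> borel_measurable (restrict_space (action_space M) (avail M x))"
              using M x unfolding is_mdp_def by blast
            then show ?case by simp
          qed
          from measurable_compose[OF measurable_pair_swap' this]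
          show "(\<lambda>(a, y). ennreal (pmf (tprob M x a) y)) \<in>
            borel_measurable (restrict_space (action_space M) (avail M x) \<Otimes>\<^sub>M count_space B)"
            by (simp add: case_prod_beta')
        qed
        moreover have "emeasure (?D a) B = (\<integral>\<^sup>+y. ennreal (pmf (tprob M x a) y) \<partial>count_space B)" for a
        proof -
          have "emeasure (?D a) B = (\<integral>\<^sup>+y. ennreal (pmf (tprob M x a) y) * indicator B y \<partial>?X)"
            using B by (subst emeasure_density) auto
          also have "\<dots> = (\<integral>\<^sup>+y. ennreal (pmf (tprob M x a) y) \<partial>count_space B)"
            using B nn_integral_restrict_space[of B ?X "\<lambda>y. ennreal (pmf (tprob M x a) y)"]
            by (simp add: restrict_count_space Int_absorb2)
          finally show ?thesis .
        qed
        ultimately show "(\<lambda>a. emeasure (?D a) B)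
          \<in> borel_measurable (restrict_space (action_space M) (avail M x))" by simp
      qed
    qed
    have "return ?X x \<in> space (prob_algebra ?X)"
      using x by (auto simp: space_prob_algebra intro!: prob_space_return)
    then show ?thesis
      unfolding trans_measure_def using D av
      by (auto intro!: measurable_If_restrict_space_iff[THEN iffD2] measurable_const)
  qed
  show ?thesis
    unfolding sa_space_def
    by (rule measurable_pair_measure_countable1[OF cX row])
qed

lemma Ionescu_Tulcea_step_kernel:
  assumes M: "is_mdp M" and x: "x \<in> states M" and \<pi>: "\<pi> \<in> policies M"
  shows "Ionescu_Tulcea (step_kernel M x \<pi>) (\<lambda>_. sa_space M)"
proof -
  have [measurable]: "\<pi> n \<in> history_space M n \<rightarrow>\<^sub>M prob_algebra (action_space M)" for n
    using \<pi> by (auto simp: policies_def)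
  note [measurable] = trans_measure_measurable[OF M]
  have K: "(\<lambda>(\<omega>, y). act_kernel M \<pi> n \<omega> y)
    \<in> (\<Pi>\<^sub>M i\<in>{0..<n}. sa_space M) \<Otimes>\<^sub>M count_space (states M) \<rightarrow>\<^sub>M prob_algebra (sa_space M)" for n
    unfolding act_kernel_def case_prod_beta'
    by (rule measurable_distr_prob_space2[where M="action_space M"])
       (use \<open>\<pi> n \<in> _\<close> in \<open>simp add: history_space_def\<close>, simp add: sa_space_def case_prod_beta')
  have "step_kernel M x \<pi> n \<in> (\<Pi>\<^sub>M i\<in>{0..<n}. sa_space M) \<rightarrow>\<^sub>M prob_algebra (sa_space M)" for n
  proof (cases n)
    case 0
    have "(\<lambda>\<omega>. (\<omega>, x)) \<in> (\<Pi>\<^sub>M i\<in>{0..<n}. sa_space M) \<rightarrow>\<^sub>M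
      (\<Pi>\<^sub>M i\<in>{0..<n}. sa_space M) \<Otimes>\<^sub>M count_space (states M)"
      using x by (auto intro!: measurable_Pair measurable_const)
    from measurable_compose[OF this K] show ?thesis using 0 by (simp add: step_kernel.simps[abs_def])
  next
    case (Suc m)
    have "(\<lambda>\<omega>. trans_measure M (\<omega> m)) \<in> (\<Pi>\<^sub>M i\<in>{0..<n}. sa_space M) \<rightarrow>\<^sub>M prob_algebra (count_space (states M))"
      using Suc by (intro measurable_compose[OF measurable_component_singleton
                 [where M="\<lambda>_. sa_space M"] trans_measure_measurable[OF M]]) auto
    from measurable_bind_prob_space2[OF this K[of n]] show ?thesis
      using Suc by (simp add: step_kernel.simps[abs_def])
  qed
  note S = this
  show ?thesis
  proof (rule Ionescu_Tulcea.intro)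
    show "step_kernel M x \<pi> i \<in> (\<Pi>\<^sub>M j\<in>{0..<i}. sa_space M) \<rightarrow>\<^sub>M subprob_algebra (sa_space M)" for i
      using S by (rule measurable_prob_algebraD)
    show "prob_space (step_kernel M x \<pi> i \<omega>)" if "\<omega> \<in> space (\<Pi>\<^sub>M j\<in>{0..<i}. sa_space M)" for i \<omega>
      using measurable_space[OF S that] by (simp add: space_prob_algebra)
  qed
qed

end

theory Submission
  imports Defs "HOL-Real_Asymp.Real_Asymp"
begin

text \<open>
  If every state has a single action and state n moves to n + 1, then the policy is irrelevant,
  and the four costs are the lower and upper limits of the Cesaro and Abel means of the cost
  sequence c. So it is enough to find nonnegative sequences with the four patterns.

  Three kinds of spikes suffice. Take 2^k at time 2^k: the Cesaro means have liminf 1 and are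
  at most 2, while the Abel means are at most 2 but stay above 1 by a fixed margin, because the Abel
  kernel averages over a whole dyadic block. Now let p be a very rapidly growing sequence of times.
  Spikes p(k) at time p(k) have both liminfs 0, Cesaro limsup at least 1, and Abel limsup strictly
  between 0 and 1, because near the k-th spike the Abel mean is about s exp(-s) with
  s = (1 - alpha) p(k). Spikes p(k)^2 at time p(k) have both liminfs 0 and both limsups infinite.
  The four patterns are realised by dyadic + 16 * linear, quadratic, dyadic + quadratic, and
  linear spikes.
\<close>

section \<open>Decision processes with a single action\<close>

text \<open>The state records the time. The action space is itself a one-point space, not merely a
  larger space with one available action, so a probability measure on it is determined.\<close>

definition clock_mdp :: "(nat \<Rightarrow> real) \<Rightarrow> (nat, nat) mdp" where
  "clock_mdp c = \<lparr>states = UNIV, action_space = count_space {0}, avail = (\<lambda>_. {0}),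
     tprob = (\<lambda>x _. return_pmf (Suc x)), cost = (\<lambda>x _. c x)\<rparr>"

lemma clock_mdp_simps [simp]:
  "states (clock_mdp c) = UNIV" "action_space (clock_mdp c) = count_space {0}"
  "avail (clock_mdp c) x = {0}" "tprob (clock_mdp c) x a = return_pmf (Suc x)"
  "cost (clock_mdp c) x a = c x"
  by (simp_all add: clock_mdp_def)

lemma is_mdp_clock_mdp:
  assumes "\<And>n. K \<le> c n"
  shows "is_mdp (clock_mdp c)"
  using assms by (auto simp: is_mdp_def restrict_count_space)

lemma sa_space_clock_mdp: "sa_space (clock_mdp c) = count_space (UNIV \<times> {0})"
  by (simp add: sa_space_def pair_measure_countable)

text \<open>This is why the policy has no influence: the only measurable sets are the empty set and
  the whole space, and a probability measure has prescribed values on both.\<close>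

lemma prob_space_count_space_singleton:
  assumes "N \<in> space (prob_algebra (count_space {a}))"
  shows "N = return (count_space {a}) a"
proof (rule measure_eqI)
  have s: "sets N = sets (count_space {a})" and N: "prob_space N"
    using assms by (auto simp: space_prob_algebra)
  from s show "sets N = sets (return (count_space {a}) a)" by simp
  fix A assume "A \<in> sets N"
  then have "A = {} \<or> A = space N"
    using s sets_eq_imp_space_eq[OF s] by auto
  then show "emeasure N A = emeasure (return (count_space {a}) a) A"
    using prob_space.emeasure_space_1[OF N] sets_eq_imp_space_eq[OF s] by auto
qed

lemma trans_measure_clock_mdp:
  "trans_measure (clock_mdp c) (x, 0) = return (count_space UNIV) (Suc x)"
  using measure_pmf_eq_density[of "return_pmf (Suc x)"]
  by (simp add: trans_measure_def return_pmf.rep_eq)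

text \<open>Both the transition and the action are point masses. Histories with
  \<open>\<omega> i = (i, 0)\<close> suffice, since the induction that builds the trajectory law
  never leaves them.\<close>

lemma step_kernel_clock_mdp:
  assumes \<pi>: "\<pi> \<in> policies (clock_mdp c)"
    and \<omega>: "\<omega> \<in> space (\<Pi>\<^sub>M i\<in>{0..<n}. sa_space (clock_mdp c))"
    and pos: "\<And>i. i < n \<Longrightarrow> \<omega> i = (i, 0)"
  shows "step_kernel (clock_mdp c) 0 \<pi> n \<omega> = return (sa_space (clock_mdp c)) (n, 0)"
proof -
  let ?M = "clock_mdp c"
  have pol: "\<pi> n (\<omega>, y) = return (count_space {0}) 0" for y
  proof (rule prob_space_count_space_singleton)
    have "\<pi> n \<in> history_space ?M n \<rightarrow>\<^sub>M prob_algebra (count_space {0})"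
      using \<pi> by (auto simp: policies_def)
    moreover have "(\<omega>, y) \<in> space (history_space ?M n)"
      using \<omega> by (simp add: history_space_def space_pair_measure)
    ultimately show "\<pi> n (\<omega>, y) \<in> space (prob_algebra (count_space {0}))"
      by (rule measurable_space)
  qed
  have act: "act_kernel ?M \<pi> n \<omega> y = return (sa_space ?M) (y, 0)" for y
    unfolding act_kernel_def pol by (subst distr_return) (auto simp: sa_space_clock_mdp)
  show ?thesis
  proof (cases n)
    case 0
    then show ?thesis using act[of 0] by simp
  next
    case (Suc m)
    have "step_kernel ?M 0 \<pi> n \<omega> = return (count_space UNIV) n \<bind> act_kernel ?M \<pi> n \<omega>"
      using Suc pos[of m] by (simp add: trans_measure_clock_mdp)
    also have "\<dots> = act_kernel ?M \<pi> n \<omega> n"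
    proof (rule bind_return[where N = "sa_space ?M"])
      show "act_kernel ?M \<pi> n \<omega> \<in> count_space UNIV \<rightarrow>\<^sub>M subprob_algebra (sa_space ?M)"
        by (auto simp: act space_subprob_algebra sa_space_clock_mdp
            intro!: prob_space_imp_subprob_space prob_space_return)
    qed auto
    finally show ?thesis by (simp add: act)
  qed
qed

text \<open>By induction every finite-dimensional law is a point mass. Each coordinate of the
  projective limit is therefore almost surely fixed, and countably many null sets can be
  united.\<close>

lemma AE_traj_clock_mdp:
  assumes c: "\<And>n. 0 \<le> c n" and \<pi>: "\<pi> \<in> policies (clock_mdp c)"
  shows "prob_space (traj_measure (clock_mdp c) 0 \<pi>)"
    and "AE \<omega> in traj_measure (clock_mdp c) 0 \<pi>. \<forall>n. \<omega> n = (n, 0)"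
proof -
  let ?M = "clock_mdp c"
  let ?S = "\<lambda>_ :: nat. sa_space ?M"
  \<comment> \<open>The restriction makes the history extensional, as membership in the space of
    \<open>PiM {0..<n} ?S\<close> requires.\<close>
  let ?\<tau> = "\<lambda>n. \<lambda>i\<in>{0..<n}. (i, 0 :: nat)"
  interpret IT: Ionescu_Tulcea "step_kernel ?M 0 \<pi>" ?S
    using is_mdp_clock_mdp[of 0 c] c \<pi> by (intro Ionescu_Tulcea_step_kernel) auto
  have traj: "traj_measure ?M 0 \<pi> = IT.PF.lim"
    by (simp add: traj_measure_def)
  have \<tau>: "?\<tau> n \<in> space (PiM {0..<n} ?S)" for n
    by (auto simp: space_PiM sa_space_clock_mdp)
  have C: "IT.C 0 n (\<lambda>_. undefined) = return (PiM {0..<n} ?S) (?\<tau> n)" for n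
  proof (induction n)
    case 0
    then show ?case by (simp add: restrict_def)
  next
    case (Suc n)
    have "IT.C 0 (Suc n) (\<lambda>_. undefined) = IT.eP n (?\<tau> n)"
      unfolding IT.C.simps Suc add_0
      using IT.measurable_eP[of n] \<tau>[of n] by (rule bind_return)
    also have "\<dots> = distr (return (?S n) (n, 0)) (PiM {0..<Suc n} ?S) (fun_upd (?\<tau> n) n)"
      unfolding IT.eP_def by (subst step_kernel_clock_mdp[OF \<pi> \<tau>]) auto
    also have "\<dots> = return (PiM {0..<Suc n} ?S) ((?\<tau> n)(n := (n, 0)))"
      by (rule distr_return) 
         (use \<tau>[of n] in \<open>auto simp: sa_space_clock_mdp space_PiM PiE_iff extensional_def intro!: measurable_fun_upd[where J="{0..<n}"]\<close>)
    also have "(?\<tau> n)(n := (n, 0)) = ?\<tau> (Suc n)"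
      by (auto simp: fun_eq_iff)
    finally show ?case .
  qed
  \<comment> \<open>Projecting to the empty set of coordinates preserves total mass, and the
    projected measure is a probability measure by the projective family.\<close>
  have ps: "prob_space IT.PF.lim"
  proof (rule prob_space_distrD)
    show "(\<lambda>\<omega>. restrict \<omega> {}) \<in> IT.PF.lim \<rightarrow>\<^sub>M PiM {} ?S"
      by (auto intro!: measurable_restrict simp: measurable_cong_sets[OF IT.PF.sets_lim refl])
    show "prob_space (distr IT.PF.lim (PiM {} ?S) (\<lambda>\<omega>. restrict \<omega> {}))"
      by (simp only: IT.distr_lim finite.emptyI IT.PF.prob_space_P subset_UNIV)
  qed
  then show "prob_space (traj_measure ?M 0 \<pi>)" by (simp add: traj)
  have "AE \<omega> in IT.PF.lim. \<omega> n = (n, 0)" for n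
  proof -
    let ?J = "{0..<Suc n}"
    \<comment> \<open>\<open>IT.CI ?J\<close> is the law \<open>IT.C\<close> up to the least bound
      of \<open>?J\<close>, restricted to \<open>?J\<close>; for this initial segment nothing is cut
      off.\<close>
    have up: "IT.up_to ?J = Suc n"
      unfolding IT.up_to_def by (rule Least_equality) (auto simp: not_le[symmetric])
    have CI: "IT.CI ?J = return (PiM ?J ?S) (?\<tau> (Suc n))"
      unfolding IT.CI_def up C
      by (subst distr_return) (auto intro!: measurable_restrict \<tau>)
    have "AE \<omega> in distr IT.PF.lim (PiM ?J ?S) (\<lambda>\<omega>. restrict \<omega> ?J). \<omega> n = (n, 0)"
    proof -
      have "{\<omega> \<in> space (PiM ?J ?S). \<omega> n = (n, 0)} \<in> sets (PiM ?J ?S)"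
      proof -
        have "(\<lambda>\<omega>. \<omega> n) \<in> PiM ?J ?S \<rightarrow>\<^sub>M ?S n"
          by (rule measurable_component_singleton) auto
        from measurable_sets[OF this, of "{(n, 0)}"] show ?thesis
          by (simp add: sa_space_clock_mdp vimage_def Int_def conj_commute)
      qed
      then show ?thesis
        unfolding IT.distr_lim[OF finite_atLeastLessThan] CI
        using \<tau>[of "Suc n"] by (subst AE_return) (auto simp: pred_def)
    qed
    then have "AE \<omega> in IT.PF.lim. restrict \<omega> ?J n = (n, 0)"
      by (rule AE_distrD[rotated])
         (auto intro!: measurable_restrict simp: measurable_cong_sets[OF IT.PF.sets_lim refl])
    then show ?thesis by simp
  qed
  then show "AE \<omega> in traj_measure ?M 0 \<pi>. \<forall>n. \<omega> n = (n, 0)"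
    unfolding traj AE_all_countable by blast
qed

text \<open>Since \<open>0 \<le> v\<close>, the integral of the negative part is 0 and no difference
  of infinities arises.\<close>

lemma ereal_expectation_AE_const:
  assumes "prob_space N" "AE \<omega> in N. f \<omega> = ereal v" "0 \<le> v"
  shows "ereal_expectation N f = ereal v"
proof -
  interpret prob_space N by fact
  have "(\<integral>\<^sup>+\<omega>. e2ennreal (f \<omega>) \<partial>N) = (\<integral>\<^sup>+\<omega>. ennreal v \<partial>N)"
    by (rule nn_integral_cong_AE) (use assms(2) in \<open>eventually_elim, simp add: ennreal.rep_eq e2ennreal_ereal\<close>)
  moreover have "(\<integral>\<^sup>+\<omega>. e2ennreal (- f \<omega>) \<partial>N) = (\<integral>\<^sup>+\<omega>. 0 \<partial>N)"
    by (rule nn_integral_cong_AE)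
       (use assms(2) in \<open>eventually_elim, use assms(3) in \<open>auto simp: ennreal_neg\<close>\<close>)
  ultimately show ?thesis
    using assms(3) by (simp add: ereal_expectation_def emeasure_space_1 enn2ereal_ennreal zero_ennreal.rep_eq)
qed

section \<open>Costs of the clock process as means of its cost sequence\<close>

definition cesaro_mean :: "(nat \<Rightarrow> real) \<Rightarrow> nat \<Rightarrow> real" where
  "cesaro_mean c N = (\<Sum>n<N. c n) / real N"

text \<open>The real infinite sum is meaningful only for a summable series, so summability
  accompanies the estimates of this quantity below.\<close>

definition abel_mean :: "(nat \<Rightarrow> real) \<Rightarrow> real \<Rightarrow> real" where
  "abel_mean c \<alpha> = (1 - \<alpha>) * (\<Sum>n. \<alpha> ^ n * c n)"

lemma stationary_clock_mdp:
  "stationary (clock_mdp c) (\<lambda>_ _. return (count_space {0}) 0)"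
proof -
  have "return (count_space {0 :: nat}) 0 \<in> space (prob_algebra (count_space {0}))"
    by (auto simp: space_prob_algebra intro!: prob_space_return)
  then show ?thesis
    by (auto simp: stationary_def policies_def intro!: exI[of _ "\<lambda>_. 0"])
qed

context
  fixes c :: "nat \<Rightarrow> real"
  assumes nonneg: "\<And>n. 0 \<le> c n"
begin

text \<open>The case \<open>N = 0\<close> is included: division by zero makes both sides 0.\<close>

lemma average_cost_clock_mdp:
  assumes "\<pi> \<in> policies (clock_mdp c)"
  shows "average_cost (clock_mdp c) N 0 \<pi> = ereal (cesaro_mean c N)"
proof -
  note traj = AE_traj_clock_mdp[OF nonneg assms]
  have "ereal_expectation (traj_measure (clock_mdp c) 0 \<pi>)
      (\<lambda>\<omega>. ereal (\<Sum>n<N. step_cost (clock_mdp c) (\<omega> n))) = ereal (\<Sum>n<N. c n)"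
  proof (rule ereal_expectation_AE_const[OF traj(1)])
    show "AE \<omega> in traj_measure (clock_mdp c) 0 \<pi>.
        ereal (\<Sum>n<N. step_cost (clock_mdp c) (\<omega> n)) = ereal (\<Sum>n<N. c n)"
      using traj(2) by eventually_elim (simp add: step_cost_def)
  qed (simp add: nonneg sum_nonneg)
  then show ?thesis
    by (simp add: average_cost_def cesaro_mean_def)
qed

lemma discounted_cost_clock_mdp:
  assumes "\<pi> \<in> policies (clock_mdp c)" "0 \<le> \<alpha>" "summable (\<lambda>n. \<alpha> ^ n * c n)"
  shows "ereal (1 - \<alpha>) * discounted_cost (clock_mdp c) \<alpha> 0 \<pi> = ereal (abel_mean c \<alpha>)"
proof -
  note traj = AE_traj_clock_mdp[OF nonneg assms(1)]
  have "discounted_cost (clock_mdp c) \<alpha> 0 \<pi> = ereal (\<Sum>n. \<alpha> ^ n * c n)"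
    unfolding discounted_cost_def
  proof (rule ereal_expectation_AE_const[OF traj(1)])
    show "AE \<omega> in traj_measure (clock_mdp c) 0 \<pi>.
        (\<Sum>n. ereal (\<alpha> ^ n * step_cost (clock_mdp c) (\<omega> n))) = ereal (\<Sum>n. \<alpha> ^ n * c n)"
      using traj(2)
      by eventually_elim (use assms in \<open>simp add: step_cost_def suminf_ereal'\<close>)
  qed (use assms nonneg in \<open>auto intro!: suminf_nonneg\<close>)
  then show ?thesis by (simp add: abel_mean_def)
qed

end

lemma optimal_value_const:
  assumes "policies M \<noteq> {}" "\<And>\<pi>. \<pi> \<in> policies M \<Longrightarrow> g M x \<pi> = v"
  shows "optimal_value g M x = v"
  using assms by (simp add: optimal_value_def)

definition cesaro_liminf :: "(nat \<Rightarrow> real) \<Rightarrow> ereal" where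
  "cesaro_liminf c = liminf (\<lambda>N. ereal (cesaro_mean c N))"

definition cesaro_limsup :: "(nat \<Rightarrow> real) \<Rightarrow> ereal" where
  "cesaro_limsup c = limsup (\<lambda>N. ereal (cesaro_mean c N))"

definition abel_liminf :: "(nat \<Rightarrow> real) \<Rightarrow> ereal" where
  "abel_liminf c = Liminf (at_left 1) (\<lambda>\<alpha>. ereal (abel_mean c \<alpha>))"

definition abel_limsup :: "(nat \<Rightarrow> real) \<Rightarrow> ereal" where
  "abel_limsup c = Limsup (at_left 1) (\<lambda>\<alpha>. ereal (abel_mean c \<alpha>))"

lemma clock_mdp_costs:
  assumes c: "\<And>n. 0 \<le> c n"
    and sm: "\<And>\<alpha>. 0 < \<alpha> \<Longrightarrow> \<alpha> < 1 \<Longrightarrow> summable (\<lambda>n. \<alpha> ^ n * c n)"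
    and \<pi>: "\<pi> \<in> policies (clock_mdp c)"
  shows "cesaro_lower (clock_mdp c) 0 \<pi> = cesaro_liminf c"
    "cesaro_upper (clock_mdp c) 0 \<pi> = cesaro_limsup c"
    "abel_lower (clock_mdp c) 0 \<pi> = abel_liminf c"
    "abel_upper (clock_mdp c) 0 \<pi> = abel_limsup c"
proof -
  show "cesaro_lower (clock_mdp c) 0 \<pi> = cesaro_liminf c"
    "cesaro_upper (clock_mdp c) 0 \<pi> = cesaro_limsup c"
    by (simp_all add: cesaro_lower_def cesaro_upper_def cesaro_liminf_def cesaro_limsup_def
        average_cost_clock_mdp[OF c \<pi>])
  \<comment> \<open>The left limit at 1 sees only discount factors in (0, 1), where
    \<open>sm\<close> provides summability.\<close>
  have "eventually (\<lambda>\<alpha>. \<alpha> \<in> {0<..<1}) (at_left (1 :: real))"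
    by (rule eventually_at_leftI[of 0]) auto
  then have ev: "eventually (\<lambda>\<alpha>. ereal (1 - \<alpha>) * discounted_cost (clock_mdp c) \<alpha> 0 \<pi>
      = ereal (abel_mean c \<alpha>)) (at_left 1)"
    by eventually_elim (use sm in \<open>auto intro!: discounted_cost_clock_mdp[OF c \<pi>]\<close>)
  show "abel_lower (clock_mdp c) 0 \<pi> = abel_liminf c"
    unfolding abel_lower_def abel_liminf_def by (rule Liminf_eq[OF ev])
  show "abel_upper (clock_mdp c) 0 \<pi> = abel_limsup c"
    unfolding abel_upper_def abel_limsup_def by (rule Limsup_eq[OF ev])
qed

text \<open>All policies have the same four costs, so the infima coincide with the costs of the
  stationary policy and both instances of \<open>R\<close> speak of the same four numbers.\<close>

lemma ex_mdp_of_cost_sequence: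
  assumes c: "\<And>n. 0 \<le> c n"
    and sm: "\<And>\<alpha>. 0 < \<alpha> \<Longrightarrow> \<alpha> < 1 \<Longrightarrow> summable (\<lambda>n. \<alpha> ^ n * c n)"
    and R: "R (cesaro_liminf c) (abel_liminf c) (abel_limsup c) (cesaro_limsup c)"
  shows "\<exists>(M :: (nat, nat) mdp) x \<phi>.
          is_mdp M \<and> infinite (states M) \<and> x \<in> states M \<and> stationary M \<phi> \<and>
          R (cesaro_lower M x \<phi>) (abel_lower M x \<phi>) (abel_upper M x \<phi>) (cesaro_upper M x \<phi>) \<and>
          R (optimal_value cesaro_lower M x) (optimal_value abel_lower M x)
            (optimal_value abel_upper M x) (optimal_value cesaro_upper M x)"
proof -
  let ?M = "clock_mdp c" and ?\<phi> = "\<lambda>_ _. return (count_space {0 :: nat}) 0"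
  have st: "stationary ?M ?\<phi>" by (rule stationary_clock_mdp)
  then have \<phi>: "?\<phi> \<in> policies ?M" by (simp add: stationary_def)
  then have ne: "policies ?M \<noteq> {}" by blast
  have costs: "cesaro_lower ?M 0 \<pi> = cesaro_liminf c" "cesaro_upper ?M 0 \<pi> = cesaro_limsup c"
    "abel_lower ?M 0 \<pi> = abel_liminf c" "abel_upper ?M 0 \<pi> = abel_limsup c"
    if "\<pi> \<in> policies ?M" for \<pi>
    using clock_mdp_costs[OF c _ that] sm by blast+
  have "optimal_value cesaro_lower ?M 0 = cesaro_liminf c"
    using ne costs(1) by (rule optimal_value_const)
  moreover have "optimal_value cesaro_upper ?M 0 = cesaro_limsup c"
    using ne costs(2) by (rule optimal_value_const)
  moreover have "optimal_value abel_lower ?M 0 = abel_liminf c"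
    using ne costs(3) by (rule optimal_value_const)
  moreover have "optimal_value abel_upper ?M 0 = abel_limsup c"
    using ne costs(4) by (rule optimal_value_const)
  ultimately show ?thesis
    using R st costs[OF \<phi>] is_mdp_clock_mdp[of 0 c, OF c]
    by (intro exI[of _ ?M] exI[of _ 0] exI[of _ ?\<phi>]) simp
qed

section \<open>Cesaro and Abel means\<close>

text \<open>Every set that is eventual for \<open>F\<close> contains a tail of the sequence
  \<open>a\<close>. Only the lower bounds \<open>x\<close> must converge; the values
  \<open>f (a n)\<close> need not.\<close>

lemma le_Limsup_along:
  fixes f :: "'a \<Rightarrow> ereal"
  assumes a: "filterlim a F sequentially" and x: "x \<longlonglongrightarrow> L" and le: "\<And>n. x n \<le> f (a n)"
  shows "L \<le> Limsup F f"
  unfolding Limsup_def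
proof (rule INF_greatest)
  fix P assume "P \<in> {P. eventually P F}"
  then have "eventually (\<lambda>n. P (a n)) sequentially"
    using a by (auto simp: filterlim_iff)
  then have "eventually (\<lambda>n. x n \<le> (SUP y\<in>{y. P y}. f y)) sequentially"
    by eventually_elim (use le in \<open>auto intro: order_trans[OF _ SUP_upper]\<close>)
  with x show "L \<le> (SUP y\<in>{y. P y}. f y)"
    by (rule tendsto_upperbound) simp
qed

lemma Liminf_along_le:
  fixes f :: "'a \<Rightarrow> ereal"
  assumes a: "filterlim a F sequentially" and x: "x \<longlonglongrightarrow> L" and le: "\<And>n. f (a n) \<le> x n"
  shows "Liminf F f \<le> L"
  unfolding Liminf_def
proof (rule SUP_least)
  fix P assume "P \<in> {P. eventually P F}"
  then have "eventually (\<lambda>n. P (a n)) sequentially"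
    using a by (auto simp: filterlim_iff)
  then have "eventually (\<lambda>n. (INF y\<in>{y. P y}. f y) \<le> x n) sequentially"
    by eventually_elim (use le in \<open>auto intro: order_trans[OF INF_lower]\<close>)
  with x show "(INF y\<in>{y. P y}. f y) \<le> L"
    by (rule tendsto_lowerbound) simp
qed

text \<open>Geometric decay beats \<open>n ^ 4\<close>, so \<open>\<alpha> ^ n * n ^ 2\<close> is
  eventually below \<open>1 / n ^ 2\<close>.\<close>

lemma summable_power_mult_quadratic:
  fixes c :: "nat \<Rightarrow> real"
  assumes "0 < \<alpha>" "\<alpha> < 1" and c: "\<And>n. 0 \<le> c n" "\<And>n. c n \<le> K * (real n)\<^sup>2"
  shows "summable (\<lambda>n. \<alpha> ^ n * c n)"
proof -
  have "summable (\<lambda>n. \<alpha> ^ n * (real n)\<^sup>2)"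
  proof (rule summable_comparison_test_ev)
    show "summable (\<lambda>n. inverse (real n ^ 2))"
      by (rule inverse_power_summable) simp
    have "((\<lambda>n. \<alpha> ^ n * real n ^ 4) \<longlongrightarrow> 0) at_top"
      using assms(1,2) by real_asymp
    then have "eventually (\<lambda>n. \<alpha> ^ n * real n ^ 4 < 1) at_top"
      by (rule order_tendstoD) simp
    with eventually_gt_at_top[of 0]
    show "eventually (\<lambda>n. norm (\<alpha> ^ n * (real n)\<^sup>2) \<le> inverse (real n ^ 2)) at_top"
    proof eventually_elim
      case (elim n)
      have "\<alpha> ^ n * (real n)\<^sup>2 * (real n)\<^sup>2 = \<alpha> ^ n * real n ^ 4"
        by (simp add: power4_eq_xxxx power2_eq_square)
      then have "\<alpha> ^ n * (real n)\<^sup>2 * (real n)\<^sup>2 \<le> 1" using elim(2) by linarith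
      then show ?case using elim assms(1) by (simp add: field_simps)
    qed
  qed
  then have "summable (\<lambda>n. K * (\<alpha> ^ n * (real n)\<^sup>2))"
    by (rule summable_mult)
  then show ?thesis
  proof (rule summable_comparison_test'[where N = 0])
    fix n
    have "\<alpha> ^ n * c n \<le> \<alpha> ^ n * (K * (real n)\<^sup>2)"
      using assms by (intro mult_left_mono) auto
    then show "norm (\<alpha> ^ n * c n) \<le> K * (\<alpha> ^ n * (real n)\<^sup>2)"
      using assms by (simp add: algebra_simps)
  qed
qed

lemma abel_mean_ge_term:
  assumes "0 \<le> \<alpha>" "\<alpha> \<le> 1" "\<And>n. 0 \<le> c n" "summable (\<lambda>n. \<alpha> ^ n * c n)"
  shows "(1 - \<alpha>) * (\<alpha> ^ m * c m) \<le> abel_mean c \<alpha>"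
proof -
  have "(\<Sum>n\<in>{m}. \<alpha> ^ n * c n) \<le> (\<Sum>n. \<alpha> ^ n * c n)"
    using assms by (intro sum_le_suminf) auto
  then show ?thesis
    using assms unfolding abel_mean_def by (intro mult_left_mono) auto
qed

lemma abel_mean_add_mult:
  assumes "summable (\<lambda>n. \<alpha> ^ n * c n)" "summable (\<lambda>n. \<alpha> ^ n * d n)"
  shows "abel_mean (\<lambda>n. c n + k * d n) \<alpha> = abel_mean c \<alpha> + k * abel_mean d \<alpha>"
proof -
  have "(\<lambda>n. \<alpha> ^ n * c n + k * (\<alpha> ^ n * d n)) sums
      ((\<Sum>n. \<alpha> ^ n * c n) + k * (\<Sum>n. \<alpha> ^ n * d n))"
    using assms by (intro sums_add sums_mult summable_sums)
  then have "(\<Sum>n. \<alpha> ^ n * (c n + k * d n)) = (\<Sum>n. \<alpha> ^ n * c n) + k * (\<Sum>n. \<alpha> ^ n * d n)"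
    by (simp add: sums_iff algebra_simps)
  then show ?thesis by (simp add: abel_mean_def algebra_simps)
qed

lemma abel_mean_mono:
  assumes "0 \<le> \<alpha>" "\<alpha> \<le> 1" "\<And>n. c n \<le> d n"
    "summable (\<lambda>n. \<alpha> ^ n * c n)" "summable (\<lambda>n. \<alpha> ^ n * d n)"
  shows "abel_mean c \<alpha> \<le> abel_mean d \<alpha>"
  unfolding abel_mean_def using assms by (intro mult_left_mono suminf_le) auto

lemma cesaro_mean_add_mult:
  "cesaro_mean (\<lambda>n. c n + k * d n) N = cesaro_mean c N + k * cesaro_mean d N"
  by (simp add: cesaro_mean_def sum.distrib sum_distrib_left add_divide_distrib)

lemma cesaro_mean_mono:
  assumes "\<And>n. c n \<le> d n"
  shows "cesaro_mean c N \<le> cesaro_mean d N"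
  unfolding cesaro_mean_def using assms by (intro divide_right_mono sum_mono) auto

text \<open>Bernoulli's inequality with the full exponent would give only 0 at
  \<open>t * m = 1\<close>. With half the exponent it gives 1/2, and squaring gives 1/4; this is the
  use of evenness.\<close>

lemma one_minus_inverse_power_ge:
  assumes "even m" "0 < m" "0 \<le> t" "t * real m \<le> 1"
  shows "1 / 4 \<le> (1 - t :: real) ^ m"
proof -
  obtain h where h: "m = 2 * h" using assms(1) by (auto elim: evenE)
  have "t \<le> 1 / 2"
  proof -
    have "t * 2 \<le> t * real m" using h assms by (intro mult_left_mono) auto
    with assms show ?thesis by linarith
  qed
  then have "1 + real h * (- t) \<le> (1 + (- t)) ^ h"
    by (intro Bernoulli_inequality) simp
  then have "1 / 2 \<le> (1 - t) ^ h"
    using assms(4) h by (simp add: algebra_simps)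
  then have "(1 / 2)\<^sup>2 \<le> ((1 - t) ^ h)\<^sup>2"
    by (intro power_mono) auto
  then show ?thesis
    using h by (simp add: power_mult[symmetric] power2_eq_square mult_2 power_add)
qed

section \<open>Dyadic spikes\<close>

definition spikes :: "(nat \<Rightarrow> nat) \<Rightarrow> (nat \<Rightarrow> real) \<Rightarrow> nat \<Rightarrow> real" where
  "spikes p w n = (if n \<in> range p then w n else 0)"

lemma spikes_at [simp]: "spikes p w (p k) = w (p k)"
  by (simp add: spikes_def)

lemma spikes_nonneg: "(\<And>n. 0 \<le> w n) \<Longrightarrow> 0 \<le> spikes p w n"
  by (simp add: spikes_def)

text \<open>The range stops just before the spike at \<open>p K\<close>, where for nonnegative
  weights the Cesaro mean is at its lowest before the next jump.\<close>

lemma sum_spikes: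
  assumes "strict_mono p"
  shows "(\<Sum>n<p K. spikes p w n) = (\<Sum>k<K. w (p k))"
proof -
  have "(\<Sum>n<p K. spikes p w n) = (\<Sum>n\<in>p ` {..<K}. spikes p w n)"
    by (rule sum.mono_neutral_right)
       (use assms in \<open>auto simp: spikes_def strict_mono_less\<close>)
  also have "\<dots> = (\<Sum>k<K. w (p k))"
    using assms by (subst sum.reindex) (auto intro: strict_mono_imp_inj_on)
  finally show ?thesis .
qed

lemma abel_mean_spikes:
  assumes "strict_mono p"
  shows "abel_mean (spikes p w) \<alpha> = (1 - \<alpha>) * (\<Sum>k. \<alpha> ^ p k * w (p k))"
    and "summable (\<lambda>n. \<alpha> ^ n * spikes p w n) \<longleftrightarrow> summable (\<lambda>k. \<alpha> ^ p k * w (p k))"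
proof -
  have z: "\<alpha> ^ n * spikes p w n = 0" if "n \<notin> range p" for n
    using that by (simp add: spikes_def)
  show "abel_mean (spikes p w) \<alpha> = (1 - \<alpha>) * (\<Sum>k. \<alpha> ^ p k * w (p k))"
    using suminf_mono_reindex[OF assms, of "\<lambda>n. \<alpha> ^ n * spikes p w n"] z
    by (simp add: abel_mean_def)
  show "summable (\<lambda>n. \<alpha> ^ n * spikes p w n) \<longleftrightarrow> summable (\<lambda>k. \<alpha> ^ p k * w (p k))"
    using summable_mono_reindex[OF assms, of "\<lambda>n. \<alpha> ^ n * spikes p w n"] z by simp
qed

abbreviation dyadic_spikes :: "nat \<Rightarrow> real" where
  "dyadic_spikes \<equiv> spikes ((^) 2) real"

lemma strict_mono_power2: "strict_mono ((^) (2 :: nat))"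
  by (auto intro: strict_monoI)

lemma summable_dyadic_spikes:
  assumes "0 < \<alpha>" "\<alpha> < 1"
  shows "summable (\<lambda>n. \<alpha> ^ n * dyadic_spikes n)"
  using assms
proof (rule summable_power_mult_quadratic[where K = 1])
  show "dyadic_spikes n \<le> 1 * (real n)\<^sup>2" for n
    by (auto simp: spikes_def power2_eq_square)
qed (simp add: spikes_def)

text \<open>Just before time \<open>2 ^ j\<close> the accumulated cost is
  \<open>2 ^ j - 1\<close>.\<close>

lemma cesaro_mean_dyadic_spikes_le: "cesaro_mean dyadic_spikes (2 ^ j) \<le> 1"
proof -
  have "(\<Sum>k<j. 2 ^ k) = (2 ^ j - 1 :: real)"
    by (induction j) auto
  then show ?thesis
    using sum_spikes[OF strict_mono_power2, of real j] by (simp add: cesaro_mean_def)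
qed

text \<open>The spike at \<open>2 ^ k\<close> carries the total cost that constant cost 1 spreads
  over the block, but pays it at the earliest and least discounted time.\<close>

lemma sum_dyadic_block_le:
  fixes \<alpha> :: real
  assumes "0 \<le> \<alpha>" "\<alpha> \<le> 1"
  shows "(\<Sum>n\<in>{2^k..<2^Suc k}. \<alpha> ^ n) \<le> 2 ^ k * \<alpha> ^ (2 ^ k)"
proof -
  have "(\<Sum>n\<in>{2^k..<2^Suc k :: nat}. \<alpha> ^ n) \<le> of_nat (card {2^k..<2^Suc k :: nat}) * \<alpha> ^ (2 ^ k)"
    by (rule sum_bounded_above) (use assms in \<open>auto intro: power_decreasing\<close>)
  then show ?thesis by simp
qed

text \<open>The second half of the block is bounded by its own first term, which is smaller than
  that of the whole block by the factor \<open>\<alpha> ^ (2 ^ j)\<close>.\<close>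

lemma sum_dyadic_block_excess:
  fixes \<alpha> :: real
  assumes "0 \<le> \<alpha>" "\<alpha> \<le> 1"
  shows "(\<Sum>n\<in>{2^Suc j..<2^Suc (Suc j)}. \<alpha> ^ n) + 2 ^ j * \<alpha> ^ (2 ^ Suc j) * (1 - \<alpha> ^ (2 ^ j))
    \<le> 2 ^ Suc j * \<alpha> ^ (2 ^ Suc j)"
proof -
  let ?m = "2 ^ Suc j + 2 ^ j :: nat"
  have "(\<Sum>n\<in>{2^Suc j..<2^Suc (Suc j) :: nat}. \<alpha> ^ n)
      = (\<Sum>n\<in>{2^Suc j..<?m}. \<alpha> ^ n) + (\<Sum>n\<in>{?m..<2^Suc (Suc j)}. \<alpha> ^ n)"
    by (rule sum.atLeastLessThan_concat[symmetric]) auto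
  also have "(\<Sum>n\<in>{2^Suc j..<?m}. \<alpha> ^ n) \<le> of_nat (card {2^Suc j..<?m}) * \<alpha> ^ (2 ^ Suc j)"
    by (rule sum_bounded_above) (use assms in \<open>auto intro: power_decreasing\<close>)
  also have "(\<Sum>n\<in>{?m..<2^Suc (Suc j)}. \<alpha> ^ n) \<le> of_nat (card {?m..<2^Suc (Suc j)}) * \<alpha> ^ ?m"
    by (rule sum_bounded_above) (use assms in \<open>auto intro: power_decreasing\<close>)
  finally show ?thesis
    unfolding power_add[of \<alpha>] by (simp add: algebra_simps)
qed

text \<open>The block estimates are added up. The summand 1 on the right accounts for time 0, which
  lies in no block, and the excess is kept for block \<open>Suc j\<close> only.\<close>

lemma sum_power_le_dyadic_sum:
  fixes \<alpha> :: real
  assumes "0 \<le> \<alpha>" "\<alpha> \<le> 1"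
  shows "(\<Sum>n<2^K. \<alpha> ^ n) + (if Suc j < K then 2 ^ j * \<alpha> ^ (2 ^ Suc j) * (1 - \<alpha> ^ (2 ^ j)) else 0)
    \<le> 1 + (\<Sum>k<K. 2 ^ k * \<alpha> ^ (2 ^ k))"
proof (induction K)
  case 0
  then show ?case by simp
next
  case (Suc K)
  have split: "(\<Sum>n<2^Suc K. \<alpha> ^ n) = (\<Sum>n<2^K. \<alpha> ^ n) + (\<Sum>n\<in>{2^K..<2^Suc K}. \<alpha> ^ n)"
    by (simp add: lessThan_atLeast0 sum.atLeastLessThan_concat)
  show ?case
  proof (cases "K = Suc j")
    case True
    then show ?thesis
      using Suc sum_dyadic_block_excess[OF assms, of j] unfolding split by simp
  next
    case False
    then show ?thesis
      using Suc sum_dyadic_block_le[OF assms, of K] unfolding split by (auto split: if_splits)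
  qed
qed

text \<open>The spike at \<open>2 ^ Suc K\<close> is compared with the \<open>2 ^ K\<close> times
  ending at it, each discounted no more than the spike; hence the factor 2.\<close>

lemma dyadic_sum_le_sum_power:
  fixes \<alpha> :: real
  assumes "0 \<le> \<alpha>" "\<alpha> \<le> 1"
  shows "(\<Sum>k<Suc K. 2 ^ k * \<alpha> ^ (2 ^ k)) \<le> 2 * (\<Sum>n<Suc (2^K). \<alpha> ^ n)"
proof (induction K)
  case 0
  then show ?case using assms by simp
next
  case (Suc K)
  have "of_nat (card {Suc (2^K)..<Suc (2^Suc K) :: nat}) * \<alpha> ^ (2 ^ Suc K)
      \<le> (\<Sum>n\<in>{Suc (2^K)..<Suc (2^Suc K) :: nat}. \<alpha> ^ n)"
    by (rule sum_bounded_below) (use assms in \<open>auto intro: power_decreasing\<close>)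
  moreover have "(\<Sum>n<Suc (2^Suc K). \<alpha> ^ n)
      = (\<Sum>n<Suc (2^K). \<alpha> ^ n) + (\<Sum>n\<in>{Suc (2^K)..<Suc (2^Suc K)}. \<alpha> ^ n)"
    unfolding lessThan_atLeast0 by (rule sum.atLeastLessThan_concat[symmetric]) auto
  ultimately show ?case using Suc by simp
qed

lemma abel_mean_dyadic_spikes_le:
  assumes "0 < \<alpha>" "\<alpha> < 1"
  shows "abel_mean dyadic_spikes \<alpha> \<le> 2"
proof -
  have "summable (\<lambda>k. \<alpha> ^ (2 ^ k) * real (2 ^ k))"
    using summable_dyadic_spikes[OF assms] abel_mean_spikes(2)[OF strict_mono_power2] by blast
  moreover have "(\<Sum>k<K. \<alpha> ^ (2 ^ k) * real (2 ^ k)) \<le> 2 / (1 - \<alpha>)" for K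
  proof -
    have "(\<Sum>k<K. \<alpha> ^ (2 ^ k) * real (2 ^ k)) \<le> (\<Sum>k<Suc K. \<alpha> ^ (2 ^ k) * real (2 ^ k))"
      using assms by simp
    also have "\<dots> \<le> 2 * (\<Sum>n<Suc (2^K). \<alpha> ^ n)"
      using dyadic_sum_le_sum_power[of \<alpha> K] assms by (simp add: mult.commute)
    also have "(\<Sum>n<Suc (2^K). \<alpha> ^ n) \<le> (\<Sum>n. \<alpha> ^ n)"
      using assms by (intro sum_le_suminf) auto
    also have "(\<Sum>n. \<alpha> ^ n) = 1 / (1 - \<alpha>)"
      using assms by (simp add: suminf_geometric)
    finally show ?thesis by simp
  qed
  ultimately have "(\<Sum>k. \<alpha> ^ (2 ^ k) * real (2 ^ k)) \<le> 2 / (1 - \<alpha>)"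
    by (rule suminf_le_const)
  then show ?thesis
    using assms by (simp add: abel_mean_spikes(1)[OF strict_mono_power2] field_simps)
qed

text \<open>Constant cost 1 has Abel mean 1. Passing to dyadic spikes loses at most the time 0
  contribution \<open>1 - \<alpha>\<close>, while one block gains a fixed amount.\<close>

lemma abel_mean_dyadic_spikes_ge:
  assumes "1 / 2 < \<alpha>" "\<alpha> < 1"
  shows "\<alpha> + 1 / 80 \<le> abel_mean dyadic_spikes \<alpha>"
proof -
  define t where "t = 1 - \<alpha>"
  have t: "0 < t" "t < 1 / 2" "\<alpha> = 1 - t" using assms by (auto simp: t_def)
  have sm: "summable (\<lambda>k. \<alpha> ^ (2 ^ k) * real (2 ^ k))"
    using summable_dyadic_spikes[of \<alpha>] abel_mean_spikes(2)[OF strict_mono_power2] assms by simp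
  let ?S = "\<Sum>k. \<alpha> ^ (2 ^ k) * real (2 ^ k)"
  \<comment> \<open>The block at scale 1 / t alone gives the excess 1/80.\<close>
  obtain j where j: "t * 2 ^ j \<le> 1 / 2" "1 / 4 < t * 2 ^ j"
  proof -
    define i where "i = (LEAST i. 1 / 4 < t * 2 ^ i)"
    obtain i0 :: nat where "1 / (4 * t) < 2 ^ i0"
      using real_arch_pow[of 2 "1 / (4 * t)"] by auto
    then have "1 / 4 < t * 2 ^ i0" using t by (simp add: field_simps)
    then have i: "1 / 4 < t * 2 ^ i" unfolding i_def by (rule LeastI)
    have "t * 2 ^ i \<le> 1 / 2"
    proof (cases i)
      case 0
      then show ?thesis using t by simp
    next
      case (Suc i')
      then have "\<not> 1 / 4 < t * 2 ^ i'"
        using not_less_Least[of i' "\<lambda>i. 1 / 4 < t * 2 ^ i"] by (simp add: i_def)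
      then show ?thesis using Suc by simp
    qed
    with i show ?thesis by (rule that[rotated])
  qed
  let ?e = "2 ^ j * \<alpha> ^ (2 ^ Suc j) * (1 - \<alpha> ^ (2 ^ j))"
  have "(1 - \<alpha> ^ (2 ^ K)) / t + ?e \<le> 1 + ?S" if "Suc j < K" for K
  proof -
    have "(\<Sum>k<K. 2 ^ k * \<alpha> ^ (2 ^ k)) \<le> ?S"
      using sum_le_suminf[OF sm, of "{..<K}"] assms by (simp add: mult.commute)
    then show ?thesis
      using sum_power_le_dyadic_sum[of \<alpha> K j] that assms
      by (simp add: sum_gp_strict t_def)
  qed
  moreover have "(\<lambda>K. (1 - \<alpha> ^ (2 ^ K)) / t + ?e) \<longlonglongrightarrow> (1 - 0) / t + ?e"
  proof (intro tendsto_intros)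
    have "(\<lambda>n. \<alpha> ^ n) \<longlonglongrightarrow> 0"
      using assms by (intro LIMSEQ_realpow_zero) auto
    then show "(\<lambda>K. \<alpha> ^ (2 ^ K)) \<longlonglongrightarrow> 0"
      by (rule filterlim_compose) (rule filterlim_subseq[OF strict_mono_power2])
  qed (use t in auto)
  ultimately have "1 / t + ?e \<le> 1 + ?S"
    by (intro LIMSEQ_le_const2[of _ _ "1 + ?S"]) (auto intro!: exI[of _ "Suc (Suc j)"])
  then have "t * (1 / t + ?e) \<le> t * (1 + ?S)"
    using t by (intro mult_left_mono) auto
  then have *: "1 + t * ?e \<le> t + abel_mean dyadic_spikes \<alpha>"
    using t(1) by (simp add: abel_mean_spikes(1)[OF strict_mono_power2] t_def distrib_left)
  have "1 / 4 \<le> \<alpha> ^ (2 ^ Suc j)"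
    unfolding t(3) by (rule one_minus_inverse_power_ge) (use t j in auto)
  \<comment> \<open>Multiplying by \<open>(1 + t) ^ (2 ^ j)\<close>, which is at least 5/4 because
    \<open>t * 2 ^ j > 1/4\<close>, leaves \<open>(1 - t ^ 2) ^ (2 ^ j)\<close>, at most 1.\<close>
  moreover have "1 / 5 \<le> 1 - \<alpha> ^ (2 ^ j)"
  proof -
    have "1 + real (2 ^ j) * t \<le> (1 + t) ^ (2 ^ j)"
      using t by (intro Bernoulli_inequality) simp
    then have "5 / 4 * \<alpha> ^ (2 ^ j) \<le> (1 + t) ^ (2 ^ j) * \<alpha> ^ (2 ^ j)"
      using j assms by (intro mult_right_mono) (auto simp: mult.commute)
    also have "\<dots> = (1 - t\<^sup>2) ^ (2 ^ j)"
      by (simp add: t(3) power_mult_distrib[symmetric] algebra_simps power2_eq_square)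
    also have "\<dots> \<le> 1"
      using t by (intro power_le_one) (auto simp: power2_eq_square mult_le_one)
    finally show ?thesis by simp
  qed
  ultimately have excess: "(1 / 4) * (1 / 5) \<le> \<alpha> ^ (2 ^ Suc j) * (1 - \<alpha> ^ (2 ^ j))"
    by (intro mult_mono) auto
  have "(1 / 4) * ((1 / 4) * (1 / 5)) \<le> (t * 2 ^ j) * (\<alpha> ^ (2 ^ Suc j) * (1 - \<alpha> ^ (2 ^ j)))"
    by (rule mult_mono[OF less_imp_le[OF j(2)] excess]) (use j in auto)
  then have "1 / 80 \<le> t * ?e" by (simp add: mult.assoc)
  with * show ?thesis by (simp add: t_def)
qed

section \<open>Sparse spikes\<close>

text \<open>Each time is the sixth power of the previous one, leaving room for the intermediate
  scale \<open>p ^ 3\<close>. Base 4 gives ratios of at least \<open>4 ^ 5 = 1024\<close>, and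
  powers of 2 make the dyadic Cesaro bound available at these times.\<close>

definition sparse_time :: "nat \<Rightarrow> nat" where
  "sparse_time k = 4 ^ (6 ^ k)"

lemma sparse_Suc: "sparse_time (Suc k) = sparse_time k ^ 6"
  by (simp add: sparse_time_def power_mult[symmetric] mult.commute)

lemma sparse_eq_power2: "sparse_time k = 2 ^ (2 * 6 ^ k)"
  by (simp add: sparse_time_def power_mult)

lemma sparse_ge_4: "4 \<le> sparse_time k"
proof -
  have "(4::nat) ^ 1 \<le> 4 ^ (6 ^ k)" by (intro power_increasing) auto
  then show ?thesis by (simp add: sparse_time_def)
qed

lemma even_sparse: "even (sparse_time k)"
  by (simp add: sparse_time_def)

lemma sparse_le_square: "real (sparse_time k) \<le> real (sparse_time k) * real (sparse_time k)"
  using sparse_ge_4[of k] by simp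

lemma sparse_Suc_ge: "1024 * sparse_time k \<le> sparse_time (Suc k)"
proof -
  have "4 ^ 5 * sparse_time k \<le> sparse_time k ^ 5 * sparse_time k"
    using sparse_ge_4[of k] by (intro mult_right_mono power_mono) auto
  then show ?thesis by (simp add: sparse_Suc power_Suc[symmetric] mult.commute)
qed

lemma strict_mono_sparse: "strict_mono sparse_time"
  unfolding strict_mono_Suc_iff
proof
  show "sparse_time n < sparse_time (Suc n)" for n
    using sparse_Suc_ge[of n] sparse_ge_4[of n] by linarith
qed

lemma sparse_add_ge: "1024 ^ i * sparse_time k \<le> sparse_time (k + i)"
proof (induction i)
  case (Suc i)
  then show ?case using sparse_Suc_ge[of "k + i"] by simp
qed simp

lemma filterlim_sparse: "filterlim sparse_time at_top sequentially"
  by (rule filterlim_subseq[OF strict_mono_sparse])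

lemma filterlim_real_sparse: "filterlim (\<lambda>k. real (sparse_time k)) at_top sequentially"
  by (rule filterlim_compose[OF filterlim_real_sequentially filterlim_sparse])

text \<open>The constant 1023 closes the induction, since
  \<open>1 + 1/1023 = 1024/1023\<close>.\<close>

lemma sum_sparse_le: "(\<Sum>k<K. real (sparse_time k)) \<le> sparse_time K / 1023"
proof (induction K)
  case (Suc K)
  have "1024 * real (sparse_time K) \<le> real (sparse_time (Suc K))"
    using sparse_Suc_ge[of K] by (simp flip: of_nat_le_iff[where 'a=real])
  with Suc show ?case by simp
qed simp

lemma sum_sparse_squares_le: "(\<Sum>k<Suc K. (real (sparse_time k))\<^sup>2) \<le> 2 * (real (sparse_time K))\<^sup>2"
proof (induction K)
  case (Suc K)
  have "2 * (real (sparse_time K))\<^sup>2 \<le> (1024 * real (sparse_time K))\<^sup>2"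
    by (simp add: power_mult_distrib)
  also have "\<dots> \<le> (real (sparse_time (Suc K)))\<^sup>2"
    using sparse_Suc_ge[of K] by (intro power_mono) (simp_all flip: of_nat_le_iff[where 'a=real])
  finally show ?case using Suc by simp
qed simp

abbreviation linear_spikes :: "nat \<Rightarrow> real" where
  "linear_spikes \<equiv> spikes sparse_time real"

abbreviation quadratic_spikes :: "nat \<Rightarrow> real" where
  "quadratic_spikes \<equiv> spikes sparse_time (\<lambda>n. (real n)\<^sup>2)"

lemma linear_spikes_le_quadratic_spikes: "linear_spikes n \<le> quadratic_spikes n"
  by (auto simp: spikes_def power2_eq_square sparse_le_square)

lemma summable_quadratic_spikes:
  assumes "0 < \<alpha>" "\<alpha> < 1"
  shows "summable (\<lambda>n. \<alpha> ^ n * quadratic_spikes n)"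
  using assms
  by (rule summable_power_mult_quadratic[where K = 1]) (auto simp: spikes_def)

lemma summable_linear_spikes:
  assumes "0 < \<alpha>" "\<alpha> < 1"
  shows "summable (\<lambda>n. \<alpha> ^ n * linear_spikes n)"
  using assms
  by (rule summable_power_mult_quadratic[where K = 1]) (auto simp: spikes_def power2_eq_square sparse_le_square)

text \<open>With \<open>P = sparse_time K\<close>, the cost before time \<open>P ^ 6\<close> is at
  most \<open>2 * P ^ 2\<close>. The mean is thus of order \<open>P ^ (-4)\<close>, and the weaker
  bound \<open>2 / P\<close> suffices.\<close>

lemma cesaro_mean_quadratic_spikes_le:
  "cesaro_mean quadratic_spikes (sparse_time (Suc K)) \<le> 2 / sparse_time K"
proof -
  have "2 * (real (sparse_time K))\<^sup>2 * sparse_time K \<le> 2 * (real (sparse_time K) ^ 6)"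
    using sparse_ge_4[of K] power_increasing[of 3 6 "real (sparse_time K)"]
    by (simp add: power2_eq_square power3_eq_cube)
  moreover have "(\<Sum>n<sparse_time (Suc K). quadratic_spikes n) \<le> 2 * (real (sparse_time K))\<^sup>2"
    unfolding sum_spikes[OF strict_mono_sparse] by (rule sum_sparse_squares_le)
  ultimately have "(\<Sum>n<sparse_time (Suc K). quadratic_spikes n) * sparse_time K \<le> 2 * real (sparse_time (Suc K))"
    by (smt (verit) mult_right_mono of_nat_0_le_iff of_nat_power sparse_Suc)
  then show ?thesis
    using sparse_ge_4[of K] sparse_ge_4[of "Suc K"] by (simp add: cesaro_mean_def field_simps)
qed

text \<open>The horizon \<open>p k + 1\<close> is the first that includes the spike at
  \<open>p k\<close>.\<close>

lemma cesaro_mean_spikes_ge: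
  assumes "\<And>n. 0 \<le> w n"
  shows "w (p k) / (p k + 1) \<le> cesaro_mean (spikes p w) (p k + 1)"
proof -
  have "w (p k) = (\<Sum>n\<in>{p k}. spikes p w n)" by simp
  also have "\<dots> \<le> (\<Sum>n<p k + 1. spikes p w n)"
    by (rule sum_mono2) (auto simp: spikes_def assms)
  finally show ?thesis
    unfolding cesaro_mean_def of_nat_add of_nat_1 by (intro divide_right_mono) auto
qed

lemma power_one_minus_le_exp:
  assumes "0 \<le> t" "t \<le> 1"
  shows "(1 - t) ^ n \<le> exp (- (t * real n))"
proof -
  have "1 - t \<le> exp (- t)" using exp_ge_add_one_self[of "- t"] by simp
  then have "(1 - t) ^ n \<le> exp (- t) ^ n" using assms by (intro power_mono) auto
  then show ?thesis by (simp add: exp_of_nat_mult[symmetric] mult.commute)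
qed

text \<open>Follows from \<open>x / 6 \<le> exp (x / 6)\<close>. The sixth power is enough to absorb
  both the quadratic weight and the factor \<open>P ^ 18\<close> in the tail estimate for quadratic
  spikes.\<close>

lemma exp_minus_le_power6:
  fixes x :: real
  assumes "0 < x"
  shows "exp (- x) \<le> 6 ^ 6 / x ^ 6"
proof -
  have "(x / 6) ^ 6 \<le> exp (x / 6) ^ 6"
  proof (rule power_mono)
    show "x / 6 \<le> exp (x / 6)" using exp_ge_add_one_self[of "x / 6"] by linarith
  qed (use assms in simp)
  then have "x ^ 6 / 6 ^ 6 \<le> exp x"
    by (simp add: exp_of_nat_mult[symmetric] power_divide)
  then show ?thesis
    using assms by (simp add: exp_minus field_simps)
qed

text \<open>The three bounds serve spikes well before, near and well after the time
  \<open>1 / (1 - \<alpha>)\<close>. The middle one is the maximum \<open>exp (-1)\<close>,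
  estimated by \<open>exp 1 \<ge> 1 + 1 + 1/2\<close>.\<close>

lemma mult_exp_minus_le:
  fixes s :: real
  assumes "0 \<le> s"
  shows "s * exp (- s) \<le> s" "s * exp (- s) \<le> 2 / 5" "0 < s \<Longrightarrow> s * exp (- s) \<le> 2 / s"
proof -
  show "s * exp (- s) \<le> s" using assms by (simp add: mult_left_le)
  have "s * exp (- s) \<le> exp (s - 1) * exp (- s)"
    using exp_ge_add_one_self[of "s - 1"] by (intro mult_right_mono) auto
  also have "\<dots> = inverse (exp 1)" by (simp add: exp_minus[symmetric] exp_add[symmetric])
  also have "\<dots> \<le> inverse (5 / 2)"
    using exp_lower_Taylor_quadratic[of "1 :: real"] by (intro le_imp_inverse_le) auto
  finally show "s * exp (- s) \<le> 2 / 5" by simp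
  assume "0 < s"
  moreover have "s\<^sup>2 / 2 \<le> exp s" using exp_lower_Taylor_quadratic[of s] assms by simp
  ultimately show "s * exp (- s) \<le> 2 / s"
    by (simp add: exp_minus field_simps power2_eq_square)
qed

lemma geometric_1024_sums:
  "(\<lambda>i. x / 1024 ^ i) sums (x * 1024 / 1023 :: real)"
  using sums_mult[OF geometric_sums[of "1 / 1024 :: real"], of x]
  by (simp add: power_divide field_simps)

text \<open>In the constant, 2 comes from the spikes up to index \<open>K\<close>, and
  \<open>2 * 6 ^ 6\<close> from the later ones, with \<open>1024/1023\<close> rounded up to
  2.\<close>

lemma abel_mean_quadratic_spikes_le:
  "abel_mean quadratic_spikes (1 - 1 / real (sparse_time K) ^ 3) \<le> (2 + 2 * 6 ^ 6) / sparse_time K"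
proof -
  define P where "P = real (sparse_time K)"
  define t where "t = 1 / P ^ 3"
  have P: "4 \<le> P" using sparse_ge_4[of K] by (simp add: P_def)
  then have P3: "4 ^ 3 \<le> P ^ 3" by (intro power_mono) auto
  have t: "0 < t" "t < 1" using P P3 by (auto simp: t_def)
  let ?f = "\<lambda>k. (1 - t) ^ sparse_time k * (real (sparse_time k))\<^sup>2"
  have sm: "summable ?f"
    using summable_quadratic_spikes[of "1 - t"] t abel_mean_spikes(2)[OF strict_mono_sparse] by simp
  have abel: "abel_mean quadratic_spikes (1 - t) = t * (\<Sum>k. ?f k)"
    by (simp add: abel_mean_spikes(1)[OF strict_mono_sparse])
  \<comment> \<open>For 1 - alpha = p(K)^(-3) the spikes up to p(K) are too small to matter, and those from
    p(K + 1) = p(K)^6 on come too late.\<close>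
  have past: "(\<Sum>k<Suc K. ?f k) \<le> 2 * P\<^sup>2"
  proof -
    have "(\<Sum>k<Suc K. ?f k) \<le> (\<Sum>k<Suc K. (real (sparse_time k))\<^sup>2)"
      using t by (intro sum_mono mult_left_le_one_le) (auto intro: power_le_one)
    also have "\<dots> \<le> 2 * P\<^sup>2" unfolding P_def by (rule sum_sparse_squares_le)
    finally show ?thesis .
  qed
  have tail: "?f (i + Suc K) \<le> 6 ^ 6 / P / 1024 ^ i" for i
  proof -
    define q where "q = real (sparse_time (i + Suc K))"
    have "P ^ 6 = real (sparse_time (Suc K))" by (simp add: P_def sparse_Suc)
    moreover have "1024 ^ i * real (sparse_time (Suc K)) \<le> q"
      using sparse_add_ge[of i "Suc K"] unfolding q_def
      by (simp add: add.commute flip: of_nat_le_iff[where 'a=real])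
    ultimately have q: "1024 ^ i * P ^ 6 \<le> q" by simp
    have P6: "P ^ 6 \<le> 1024 ^ i * P ^ 6" using P by simp
    have q0: "0 < q" using q P by (smt (verit) P6 zero_less_power)
    have "(1 - t) ^ sparse_time (i + Suc K) \<le> exp (- (t * q))"
      unfolding q_def using t by (intro power_one_minus_le_exp) auto
    also have "\<dots> \<le> 6 ^ 6 / (t * q) ^ 6"
      using t q0 by (intro exp_minus_le_power6) auto
    finally have "?f (i + Suc K) \<le> 6 ^ 6 / (t * q) ^ 6 * q\<^sup>2"
      unfolding q_def by (rule mult_right_mono) simp
    also have "\<dots> = 6 ^ 6 * (P ^ 6) ^ 3 / q ^ 4"
      using q0 P by (simp add: t_def power_mult_distrib power_divide field_simps power_add[symmetric] flip: power_mult)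
    \<comment> \<open>All later times satisfy \<open>q \<ge> P ^ 6\<close>, so \<open>P ^ 18\<close>
      is at most \<open>q ^ 3\<close> and a single factor \<open>1 / q\<close> remains.\<close>
    also have "\<dots> \<le> 6 ^ 6 * q ^ 3 / q ^ 4"
    proof (intro divide_right_mono mult_left_mono power_mono)
      show "P ^ 6 \<le> q" using P6 q by linarith
    qed (use q0 P in auto)
    also have "\<dots> = 6 ^ 6 / q"
      using q0 by (simp add: field_simps power4_eq_xxxx power3_eq_cube)
    also have "\<dots> \<le> 6 ^ 6 / (1024 ^ i * P)"
    proof (rule divide_left_mono)
      have "P ^ 1 \<le> P ^ 6" using P by (intro power_increasing) auto
      then have "1024 ^ i * P \<le> 1024 ^ i * P ^ 6" by simp
      with q show "1024 ^ i * P \<le> q" by linarith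
    qed (use q0 P in auto)
    finally show ?thesis by (simp add: mult.commute)
  qed
  have "(\<Sum>i. ?f (i + Suc K)) \<le> 6 ^ 6 / P * 1024 / 1023"
    by (rule sums_le[OF tail summable_sums[OF summable_ignore_initial_segment[OF sm]]
        geometric_1024_sums])
  also have "\<dots> \<le> 2 * 6 ^ 6 / P" using P by (simp add: field_simps)
  finally have future: "(\<Sum>i. ?f (i + Suc K)) \<le> 2 * 6 ^ 6 / P" .
  have "t * (\<Sum>k. ?f k) \<le> t * (2 * 6 ^ 6 / P + 2 * P\<^sup>2)"
    unfolding suminf_split_initial_segment[OF sm, of "Suc K"]
    using past future t by (intro mult_left_mono add_mono) auto
  also have "\<dots> \<le> 2 * 6 ^ 6 / P + 2 / P"
  proof -
    have "t * (2 * 6 ^ 6 / P) \<le> 2 * 6 ^ 6 / P"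
      using t P by (intro mult_left_le_one_le) auto
    moreover have "t * (2 * P\<^sup>2) = 2 / P"
      using P by (simp add: t_def power2_eq_square power3_eq_cube)
    ultimately show ?thesis by (simp add: distrib_left)
  qed
  also have "\<dots> = (2 + 2 * 6 ^ 6) / P" by (simp add: add_divide_distrib)
  finally show ?thesis unfolding abel[symmetric] by (simp add: t_def P_def)
qed

text \<open>The value 81/100 rounds up \<open>2/5 + 2/5 + 3/1023\<close>. It lies far enough below
  the Cesaro limsup, at least 1, to leave room for the dyadic spikes after scaling by 16.\<close>

lemma abel_mean_linear_spikes_le:
  assumes "0 < \<alpha>" "\<alpha> < 1"
  shows "abel_mean linear_spikes \<alpha> \<le> 81 / 100"
proof -
  define t where "t = 1 - \<alpha>"
  have t: "0 < t" "t < 1" "\<alpha> = 1 - t" using assms by (auto simp: t_def)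
  define s where "s = (\<lambda>k. t * real (sparse_time k))"
  let ?f = "\<lambda>k. t * (\<alpha> ^ sparse_time k * real (sparse_time k))"
  have smk: "summable (\<lambda>k. \<alpha> ^ sparse_time k * real (sparse_time k))"
    using summable_linear_spikes[OF assms] abel_mean_spikes(2)[OF strict_mono_sparse] by blast
  then have sm: "summable ?f" by (rule summable_mult)
  have abel: "abel_mean linear_spikes \<alpha> = (\<Sum>k. ?f k)"
    unfolding abel_mean_spikes(1)[OF strict_mono_sparse] t_def[symmetric]
    by (rule suminf_mult[OF smk, symmetric])
  have s0: "0 < s k" for k using t sparse_ge_4[of k] by (simp add: s_def)
  have f: "?f k \<le> s k * exp (- s k)" for k
  proof -
    have "\<alpha> ^ sparse_time k \<le> exp (- s k)"
      unfolding s_def t(3) using t by (intro power_one_minus_le_exp) auto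
    then have "\<alpha> ^ sparse_time k * s k \<le> exp (- s k) * s k"
      using s0[of k] by (intro mult_right_mono) auto
    then show ?thesis by (simp add: s_def mult_ac)
  qed
  obtain i0 where "1 / t \<le> real (sparse_time i0)"
    using filterlim_real_sparse by (auto simp: filterlim_at_top eventually_sequentially)
  then have i0: "1 \<le> s i0" using t by (simp add: s_def field_simps)
  define j where "j = (LEAST k. 1 \<le> s k)"
  have j: "1 \<le> s j" unfolding j_def using i0 by (rule LeastI)
  \<comment> \<open>Only the two spikes around 1 / (1 - alpha) matter: each contributes at most
    sup s exp(-s) = exp(-1), which is below 2/5, and the others form geometric series.\<close>
  have before: "(\<Sum>k<j. ?f k) \<le> 2 / 5 + 1 / 1023"
  proof (cases j)
    case (Suc i)
    then have i: "s i < 1"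
      using not_less_Least[of i "\<lambda>k. 1 \<le> s k"] by (simp add: j_def)
    have "(\<Sum>k<i. ?f k) \<le> (\<Sum>k<i. s k)"
      using f mult_exp_minus_le(1)[OF less_imp_le[OF s0]] by (intro sum_mono) (rule order_trans)
    also have "\<dots> = t * (\<Sum>k<i. real (sparse_time k))" by (simp add: s_def sum_distrib_left)
    also have "\<dots> \<le> t * (real (sparse_time i) / 1023)"
      using sum_sparse_le[of i] t by (intro mult_left_mono) auto
    also have "\<dots> \<le> 1 / 1023" using i by (simp add: s_def)
    finally show ?thesis
      using order_trans[OF f mult_exp_minus_le(2)[OF less_imp_le[OF s0]], of i] Suc by simp
  qed simp
  have tail: "?f (i + Suc j) \<le> 2 / 1024 / 1024 ^ i" for i
  proof -
    have "1024 ^ Suc i * real (sparse_time j) \<le> real (sparse_time (i + Suc j))"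
      using sparse_add_ge[of "Suc i" j]
      by (simp add: add.commute flip: of_nat_le_iff[where 'a=real])
    then have "t * (1024 ^ Suc i * real (sparse_time j)) \<le> t * real (sparse_time (i + Suc j))"
      using t by (intro mult_left_mono) auto
    then have "1024 ^ Suc i * s j \<le> s (i + Suc j)" by (simp add: s_def mult_ac)
    moreover have "1024 ^ Suc i * 1 \<le> 1024 ^ Suc i * s j" using j by (intro mult_left_mono) auto
    ultimately have "1024 ^ Suc i \<le> s (i + Suc j)" by linarith
    then have "2 / s (i + Suc j) \<le> 2 / 1024 ^ Suc i"
      by (intro divide_left_mono) (auto intro: s0 mult_pos_pos)
    moreover have "?f (i + Suc j) \<le> 2 / s (i + Suc j)"
      using f mult_exp_minus_le(3)[OF less_imp_le[OF s0] s0] by (rule order_trans)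
    ultimately show ?thesis by simp
  qed
  have after: "(\<Sum>i. ?f (i + Suc j)) \<le> 2 / 1024 * 1024 / 1023"
    by (rule sums_le[OF tail summable_sums[OF summable_ignore_initial_segment[OF sm]]
        geometric_1024_sums])
  have "?f j \<le> 2 / 5"
    using f mult_exp_minus_le(2)[OF less_imp_le[OF s0]] by (rule order_trans)
  with before after show ?thesis
    unfolding abel suminf_split_initial_segment[OF sm, of "Suc j"] by simp
qed

text \<open>At discount \<open>1 - 1 / p k\<close> the spike at \<open>p k\<close> still keeps a
  quarter of its weight, and this single term gives the bound.\<close>

lemma abel_mean_spikes_ge:
  assumes "\<And>n. 0 \<le> w n" "even (p k)" "0 < p k"
    and sm: "summable (\<lambda>n. (1 - 1 / real (p k)) ^ n * spikes p w n)"
  shows "w (p k) / (4 * p k) \<le> abel_mean (spikes p w) (1 - 1 / real (p k))"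
proof -
  let ?\<alpha> = "1 - 1 / real (p k)"
  have "1 / 4 \<le> ?\<alpha> ^ p k"
    using assms by (intro one_minus_inverse_power_ge) auto
  then have "(1 - ?\<alpha>) * (1 / 4 * w (p k)) \<le> (1 - ?\<alpha>) * (?\<alpha> ^ p k * w (p k))"
    using assms by (intro mult_left_mono mult_right_mono) auto
  also have "\<dots> \<le> abel_mean (spikes p w) ?\<alpha>"
    using abel_mean_ge_term[OF _ _ spikes_nonneg[OF assms(1)] sm, of "p k"] assms(3) by simp
  finally show ?thesis by simp
qed

section \<open>Limits along the sparse times\<close>

lemma filterlim_one_minus_inverse_sparse:
  assumes "0 < m"
  shows "filterlim (\<lambda>k. 1 - 1 / real (sparse_time k) ^ m) (at_left 1) sequentially"
proof (rule filterlim_compose[OF _ filterlim_real_sparse])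
  show "filterlim (\<lambda>x :: real. 1 - 1 / x ^ m) (at_left 1) at_top"
    using assms by real_asymp
qed

lemma tendsto_ereal_divide_sparse: "(\<lambda>k. ereal (a + b / real (sparse_time k))) \<longlonglongrightarrow> ereal a"
proof -
  have "((\<lambda>x. a + b / x) \<longlongrightarrow> a) at_top" by real_asymp
  from filterlim_compose[OF this filterlim_real_sparse] show ?thesis by simp
qed

lemma cesaro_liminf_le:
  assumes "\<And>k. cesaro_mean c (sparse_time (Suc k)) \<le> a + b / sparse_time k"
  shows "cesaro_liminf c \<le> ereal a"
  unfolding cesaro_liminf_def
proof (rule Liminf_along_le[where x = "\<lambda>k. ereal (a + b / real (sparse_time k))"])
  show "filterlim (\<lambda>k. sparse_time (Suc k)) at_top sequentially"
    by (rule filterlim_compose[OF filterlim_sparse filterlim_Suc])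
qed (use assms tendsto_ereal_divide_sparse in auto)

lemma abel_liminf_le:
  assumes "\<And>k. abel_mean c (1 - 1 / real (sparse_time k) ^ 3) \<le> a + b / sparse_time k"
  shows "abel_liminf c \<le> ereal a"
  unfolding abel_liminf_def
  by (rule Liminf_along_le[OF filterlim_one_minus_inverse_sparse[of 3] tendsto_ereal_divide_sparse])
     (use assms in auto)

lemma le_cesaro_limsup:
  assumes "x \<longlonglongrightarrow> L" "\<And>k. x k \<le> ereal (cesaro_mean c (sparse_time k + 1))"
  shows "L \<le> cesaro_limsup c"
  unfolding cesaro_limsup_def
  by (rule le_Limsup_along[where a = "\<lambda>k. sparse_time k + 1" and x = x])
     (use assms filterlim_compose[OF filterlim_Suc filterlim_sparse] in simp_all)

lemma le_abel_limsup:
  assumes "x \<longlonglongrightarrow> L" "\<And>k. x k \<le> ereal (abel_mean c (1 - 1 / real (sparse_time k)))"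
  shows "L \<le> abel_limsup c"
  unfolding abel_limsup_def
  by (rule le_Limsup_along[where a = "\<lambda>k. 1 - 1 / real (sparse_time k)" and x = x])
     (use assms filterlim_one_minus_inverse_sparse[of 1] in simp_all)

lemma le_abel_liminf:
  assumes "\<And>\<alpha>. a < \<alpha> \<Longrightarrow> \<alpha> < 1 \<Longrightarrow> v \<le> abel_mean c \<alpha>" "a < 1"
  shows "ereal v \<le> abel_liminf c"
  unfolding abel_liminf_def
  by (rule Liminf_bounded, rule eventually_at_leftI[OF _ assms(2)]) (use assms(1) in auto)

lemma abel_limsup_le:
  assumes "\<And>\<alpha>. a < \<alpha> \<Longrightarrow> \<alpha> < 1 \<Longrightarrow> abel_mean c \<alpha> \<le> v" "a < 1"
  shows "abel_limsup c \<le> ereal v"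
  unfolding abel_limsup_def
  by (rule Limsup_bounded, rule eventually_at_leftI[OF _ assms(2)]) (use assms(1) in auto)

lemma liminfs_nonneg:
  assumes "\<And>n. 0 \<le> c n" "\<And>\<alpha>. 0 < \<alpha> \<Longrightarrow> \<alpha> < 1 \<Longrightarrow> summable (\<lambda>n. \<alpha> ^ n * c n)"
  shows "0 \<le> cesaro_liminf c" "0 \<le> abel_liminf c"
proof -
  show "0 \<le> cesaro_liminf c"
    unfolding cesaro_liminf_def
    by (rule Liminf_bounded) (auto simp: cesaro_mean_def intro!: always_eventually divide_nonneg_nonneg sum_nonneg assms)
  have "ereal 0 \<le> abel_liminf c"
    by (rule le_abel_liminf[of 0]) (auto simp: abel_mean_def intro!: mult_nonneg_nonneg suminf_nonneg assms)
  then show "0 \<le> abel_liminf c" by (simp add: zero_ereal_def)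
qed

lemma one_minus_inverse_sparse:
  assumes "0 < m"
  shows "0 < 1 - 1 / real (sparse_time k) ^ m" "1 - 1 / real (sparse_time k) ^ m < 1"
proof -
  have "1 < real (sparse_time k) ^ m"
    using sparse_ge_4[of k] assms by (intro one_less_power) auto
  then show "0 < 1 - 1 / real (sparse_time k) ^ m" "1 - 1 / real (sparse_time k) ^ m < 1"
    using sparse_ge_4[of k] by (simp_all add: divide_less_eq)
qed

lemma linear_spikes_nonneg: "0 \<le> linear_spikes n"
  by (simp add: spikes_nonneg)

lemma quadratic_spikes_nonneg: "0 \<le> quadratic_spikes n"
  by (simp add: spikes_nonneg)

lemma dyadic_spikes_nonneg: "0 \<le> dyadic_spikes n"
  by (simp add: spikes_nonneg)

text \<open>For the vanishing liminf, domination by the quadratic spikes is enough.\<close>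

lemma cesaro_mean_linear_spikes_le:
  "cesaro_mean linear_spikes (sparse_time (Suc K)) \<le> 2 / sparse_time K"
  using cesaro_mean_mono[of linear_spikes quadratic_spikes, OF linear_spikes_le_quadratic_spikes]
    cesaro_mean_quadratic_spikes_le by (rule order_trans)

lemma abel_mean_linear_spikes_along_le:
  "abel_mean linear_spikes (1 - 1 / real (sparse_time K) ^ 3) \<le> (2 + 2 * 6 ^ 6) / sparse_time K"
proof -
  note \<alpha> = one_minus_inverse_sparse[of 3 K, OF zero_less_numeral]
  have "abel_mean linear_spikes (1 - 1 / real (sparse_time K) ^ 3)
      \<le> abel_mean quadratic_spikes (1 - 1 / real (sparse_time K) ^ 3)"
    using \<alpha> summable_linear_spikes[OF \<alpha>] summable_quadratic_spikes[OF \<alpha>]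
    by (intro abel_mean_mono linear_spikes_le_quadratic_spikes) auto
  then show ?thesis using abel_mean_quadratic_spikes_le by (rule order_trans)
qed

lemma abel_mean_linear_spikes_ge:
  "1 / 4 \<le> abel_mean linear_spikes (1 - 1 / real (sparse_time k))"
  using abel_mean_spikes_ge[of real sparse_time k] even_sparse[of k] sparse_ge_4[of k]
    summable_linear_spikes[OF one_minus_inverse_sparse[of 1 k, unfolded power_one_right, OF zero_less_one]]
  by simp

lemma abel_mean_quadratic_spikes_ge:
  "real (sparse_time k) / 4 \<le> abel_mean quadratic_spikes (1 - 1 / real (sparse_time k))"
  using abel_mean_spikes_ge[of "\<lambda>n. (real n)\<^sup>2" sparse_time k] even_sparse[of k] sparse_ge_4[of k]
    summable_quadratic_spikes[OF one_minus_inverse_sparse[of 1 k, unfolded power_one_right, OF zero_less_one]]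
  by (simp add: power2_eq_square)

lemma cesaro_mean_linear_spikes_ge:
  "1 - 1 / real (sparse_time k) \<le> cesaro_mean linear_spikes (sparse_time k + 1)"
proof -
  have "1 - 1 / real (sparse_time k) \<le> real (sparse_time k) / (sparse_time k + 1)"
    using sparse_ge_4[of k] by (simp add: field_simps)
  also have "\<dots> \<le> cesaro_mean linear_spikes (sparse_time k + 1)"
    using cesaro_mean_spikes_ge[of real sparse_time k] by (simp add: add.commute)
  finally show ?thesis .
qed

text \<open>The crude factor 1/4 matches the Abel bound, so one divergent minorant serves both
  limsups.\<close>

lemma cesaro_mean_quadratic_spikes_ge:
  "real (sparse_time k) / 4 \<le> cesaro_mean quadratic_spikes (sparse_time k + 1)"
proof -
  have "real (sparse_time k) / 4 \<le> (real (sparse_time k))\<^sup>2 / (sparse_time k + 1)"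
    using sparse_ge_4[of k] by (simp add: field_simps power2_eq_square)
  also have "\<dots> \<le> cesaro_mean quadratic_spikes (sparse_time k + 1)"
    using cesaro_mean_spikes_ge[of "\<lambda>n. (real n)\<^sup>2" sparse_time k] by (simp add: add.commute)
  finally show ?thesis .
qed

lemma tendsto_sparse_infinity: "(\<lambda>k. ereal (real (sparse_time k) / 4)) \<longlonglongrightarrow> \<infinity>"
proof -
  have "filterlim (\<lambda>x :: real. x / 4) at_top at_top" by real_asymp
  from filterlim_compose[OF this filterlim_real_sparse] show ?thesis
    by (simp add: tendsto_PInfty_eq_at_top)
qed

section \<open>Upper and lower limits of the pure sparse sequences\<close>

lemma cesaro_mean_nonneg: "(\<And>n. 0 \<le> c n) \<Longrightarrow> 0 \<le> cesaro_mean c N"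
  by (simp add: cesaro_mean_def sum_nonneg)

lemma abel_mean_nonneg:
  assumes "\<alpha> \<le> 1" "0 \<le> \<alpha>" "\<And>n. 0 \<le> c n" "summable (\<lambda>n. \<alpha> ^ n * c n)"
  shows "0 \<le> abel_mean c \<alpha>"
  using assms by (auto simp: abel_mean_def intro!: mult_nonneg_nonneg suminf_nonneg)

lemma linear_spikes_limits:
  "cesaro_liminf linear_spikes = 0" "abel_liminf linear_spikes = 0"
  "ereal (1 / 4) \<le> abel_limsup linear_spikes" "abel_limsup linear_spikes \<le> ereal (81 / 100)"
  "1 \<le> cesaro_limsup linear_spikes"
proof -
  have "cesaro_liminf linear_spikes \<le> ereal 0"
    using cesaro_mean_linear_spikes_le by (intro cesaro_liminf_le[where b = 2]) simp
  then show "cesaro_liminf linear_spikes = 0"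
    using liminfs_nonneg(1)[OF linear_spikes_nonneg summable_linear_spikes]
    by (simp add: zero_ereal_def[symmetric])
  have "abel_liminf linear_spikes \<le> ereal 0"
    using abel_mean_linear_spikes_along_le
    by (intro abel_liminf_le[where b = "2 + 2 * 6 ^ 6"]) simp
  then show "abel_liminf linear_spikes = 0"
    using liminfs_nonneg(2)[OF linear_spikes_nonneg summable_linear_spikes]
    by (simp add: zero_ereal_def[symmetric])
  show "ereal (1 / 4) \<le> abel_limsup linear_spikes"
    by (rule le_abel_limsup[OF tendsto_const]) (use abel_mean_linear_spikes_ge in simp)
  show "abel_limsup linear_spikes \<le> ereal (81 / 100)"
    by (rule abel_limsup_le[of 0]) (use abel_mean_linear_spikes_le in auto)
  have "ereal 1 \<le> cesaro_limsup linear_spikes"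
    by (rule le_cesaro_limsup[OF tendsto_ereal_divide_sparse[of 1 "-1"]])
       (use cesaro_mean_linear_spikes_ge in simp)
  then show "1 \<le> cesaro_limsup linear_spikes" by (simp add: one_ereal_def)
qed

lemma quadratic_spikes_limits:
  "cesaro_liminf quadratic_spikes = 0" "abel_liminf quadratic_spikes = 0"
  "abel_limsup quadratic_spikes = \<infinity>" "cesaro_limsup quadratic_spikes = \<infinity>"
proof -
  have "cesaro_liminf quadratic_spikes \<le> ereal 0"
    using cesaro_mean_quadratic_spikes_le by (intro cesaro_liminf_le[where b = 2]) simp
  then show "cesaro_liminf quadratic_spikes = 0"
    using liminfs_nonneg(1)[OF quadratic_spikes_nonneg summable_quadratic_spikes]
    by (simp add: zero_ereal_def[symmetric])
  have "abel_liminf quadratic_spikes \<le> ereal 0"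
    using abel_mean_quadratic_spikes_le
    by (intro abel_liminf_le[where b = "2 + 2 * 6 ^ 6"]) simp
  then show "abel_liminf quadratic_spikes = 0"
    using liminfs_nonneg(2)[OF quadratic_spikes_nonneg summable_quadratic_spikes]
    by (simp add: zero_ereal_def[symmetric])
  have "\<infinity> \<le> abel_limsup quadratic_spikes"
    by (rule le_abel_limsup[OF tendsto_sparse_infinity]) (use abel_mean_quadratic_spikes_ge in simp)
  then show "abel_limsup quadratic_spikes = \<infinity>" by simp
  have "\<infinity> \<le> cesaro_limsup quadratic_spikes"
    by (rule le_cesaro_limsup[OF tendsto_sparse_infinity]) (use cesaro_mean_quadratic_spikes_ge in simp)
  then show "cesaro_limsup quadratic_spikes = \<infinity>" by simp
qed

section \<open>Superposition of dyadic and sparse spikes\<close>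

lemma cesaro_mean_dyadic_spikes_sparse_le:
  "cesaro_mean dyadic_spikes (sparse_time k) \<le> 1"
  unfolding sparse_eq_power2 by (rule cesaro_mean_dyadic_spikes_le)

text \<open>Along the sparse times, and along the discounts at scale \<open>p ^ 3\<close>, the
  summand \<open>d\<close> disappears and the upper bounds 1 and 2 of the dyadic spikes remain.
  Adding \<open>d\<close> can only raise the Abel mean, so the dyadic margin above 1
  survives.\<close>

lemma dyadic_plus_sparse_liminfs:
  assumes d: "\<And>n. 0 \<le> d n" "\<And>\<alpha>. 0 < \<alpha> \<Longrightarrow> \<alpha> < 1 \<Longrightarrow> summable (\<lambda>n. \<alpha> ^ n * d n)"
    and cesaro: "\<And>k. cesaro_mean d (sparse_time (Suc k)) \<le> b / sparse_time k"
    and abel: "\<And>k. abel_mean d (1 - 1 / real (sparse_time k) ^ 3) \<le> b' / sparse_time k"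
    and m: "0 \<le> m"
  defines "c \<equiv> \<lambda>n. dyadic_spikes n + m * d n"
  shows "cesaro_liminf c \<le> 1" "1 < abel_liminf c" "abel_liminf c \<le> 2"
proof -
  have abel_c: "abel_mean c \<alpha> = abel_mean dyadic_spikes \<alpha> + m * abel_mean d \<alpha>"
    if "0 < \<alpha>" "\<alpha> < 1" for \<alpha>
    unfolding c_def using that d(2) by (intro abel_mean_add_mult summable_dyadic_spikes)
  have "cesaro_liminf c \<le> ereal 1"
  proof (rule cesaro_liminf_le[where b = "m * b"])
    fix k
    have "m * cesaro_mean d (sparse_time (Suc k)) \<le> m * (b / sparse_time k)"
      using cesaro m by (intro mult_left_mono) auto
    then show "cesaro_mean c (sparse_time (Suc k)) \<le> 1 + m * b / sparse_time k"
      unfolding c_def cesaro_mean_add_mult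
      using cesaro_mean_dyadic_spikes_sparse_le[of "Suc k"] by simp
  qed
  then show "cesaro_liminf c \<le> 1" by (simp add: one_ereal_def)
  \<comment> \<open>For \<open>\<alpha> > 1 - 1/160\<close> half of the excess 1/80 survives in
    \<open>\<alpha> + 1/80\<close>.\<close>
  have "ereal (1 + 1 / 160) \<le> abel_liminf c"
  proof (rule le_abel_liminf[of "1 - 1 / 160"])
    fix \<alpha> :: real assume \<alpha>: "1 - 1 / 160 < \<alpha>" "\<alpha> < 1"
    have "0 \<le> m * abel_mean d \<alpha>"
      using \<alpha> d m by (intro mult_nonneg_nonneg abel_mean_nonneg) auto
    then show "1 + 1 / 160 \<le> abel_mean c \<alpha>"
      using abel_mean_dyadic_spikes_ge[of \<alpha>] abel_c[of \<alpha>] \<alpha> by simp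
  qed simp
  then show "1 < abel_liminf c"
    by (rule less_le_trans[rotated]) (simp add: one_ereal_def)
  have "abel_liminf c \<le> ereal 2"
  proof (rule abel_liminf_le[where b = "m * b'"])
    fix k
    let ?\<alpha> = "1 - 1 / real (sparse_time k) ^ 3"
    have \<alpha>: "0 < ?\<alpha>" "?\<alpha> < 1" using one_minus_inverse_sparse[of 3 k] by auto
    have "m * abel_mean d ?\<alpha> \<le> m * (b' / sparse_time k)"
      using abel m by (intro mult_left_mono) auto
    then show "abel_mean c ?\<alpha> \<le> 2 + m * b' / sparse_time k"
      unfolding abel_c[OF \<alpha>] using abel_mean_dyadic_spikes_le[OF \<alpha>] by simp
  qed
  then show "abel_liminf c \<le> 2" by simp
qed

text \<open>The weight 16 makes the sparse contribution outweigh the dyadic bound 2 twice: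
  \<open>2 < 16/4\<close> and \<open>2 + 16 * 81/100 < 16\<close>.\<close>

definition mixed_linear_spikes :: "nat \<Rightarrow> real" where
  "mixed_linear_spikes n = dyadic_spikes n + 16 * linear_spikes n"

text \<open>The factor 1 keeps the form \<open>c n + k * d n\<close> of the additivity
  lemmas.\<close>

definition mixed_quadratic_spikes :: "nat \<Rightarrow> real" where
  "mixed_quadratic_spikes n = dyadic_spikes n + 1 * quadratic_spikes n"

lemma mixed_linear_spikes_limits:
  "cesaro_liminf mixed_linear_spikes < abel_liminf mixed_linear_spikes"
  "abel_liminf mixed_linear_spikes < abel_limsup mixed_linear_spikes"
  "abel_limsup mixed_linear_spikes < cesaro_limsup mixed_linear_spikes"
proof -
  note c_def = mixed_linear_spikes_def[abs_def]
  note lims = dyadic_plus_sparse_liminfs[OF linear_spikes_nonneg summable_linear_spikes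
      cesaro_mean_linear_spikes_le abel_mean_linear_spikes_along_le, of 16, folded c_def, simplified]
  have abel_c: "abel_mean mixed_linear_spikes \<alpha>
      = abel_mean dyadic_spikes \<alpha> + 16 * abel_mean linear_spikes \<alpha>" if "0 < \<alpha>" "\<alpha> < 1" for \<alpha>
    unfolding c_def using that by (intro abel_mean_add_mult summable_dyadic_spikes summable_linear_spikes)
  show "cesaro_liminf mixed_linear_spikes < abel_liminf mixed_linear_spikes"
    using lims(1,2) by (rule le_less_trans)
  have "ereal 4 \<le> abel_limsup mixed_linear_spikes"
  proof (rule le_abel_limsup[OF tendsto_const])
    fix k
    let ?\<alpha> = "1 - 1 / real (sparse_time k)"
    have \<alpha>: "0 < ?\<alpha>" "?\<alpha> < 1" using one_minus_inverse_sparse[of 1 k] by auto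
    have "0 \<le> abel_mean dyadic_spikes ?\<alpha>"
      using \<alpha> by (intro abel_mean_nonneg dyadic_spikes_nonneg summable_dyadic_spikes) auto
    then show "ereal 4 \<le> ereal (abel_mean mixed_linear_spikes ?\<alpha>)"
      unfolding abel_c[OF \<alpha>] using abel_mean_linear_spikes_ge[of k] by simp
  qed
  then show "abel_liminf mixed_linear_spikes < abel_limsup mixed_linear_spikes"
    by (rule le_less_trans[OF lims(3) less_le_trans[rotated]]) simp
  \<comment> \<open>Here 15 rounds up \<open>2 + 16 * 81/100 = 14.96\<close>.\<close>
  have "abel_limsup mixed_linear_spikes \<le> ereal 15"
  proof (rule abel_limsup_le[of 0])
    fix \<alpha> :: real assume \<alpha>: "0 < \<alpha>" "\<alpha> < 1"
    show "abel_mean mixed_linear_spikes \<alpha> \<le> 15"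
      unfolding abel_c[OF \<alpha>]
      using abel_mean_linear_spikes_le[OF \<alpha>] abel_mean_dyadic_spikes_le[OF \<alpha>] by simp
  qed simp
  also have "\<dots> < ereal 16" by simp
  also have "ereal 16 \<le> cesaro_limsup mixed_linear_spikes"
  proof (rule le_cesaro_limsup[OF tendsto_ereal_divide_sparse[of 16 "-16"]])
    fix k
    have "0 \<le> cesaro_mean dyadic_spikes (sparse_time k + 1)"
      by (rule cesaro_mean_nonneg[OF dyadic_spikes_nonneg])
    then show "ereal (16 + -16 / real (sparse_time k))
        \<le> ereal (cesaro_mean mixed_linear_spikes (sparse_time k + 1))"
      unfolding c_def cesaro_mean_add_mult using cesaro_mean_linear_spikes_ge[of k] by simp
  qed
  finally show "abel_limsup mixed_linear_spikes < cesaro_limsup mixed_linear_spikes" .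
qed

text \<open>The dyadic part separates the two liminfs while the Abel liminf stays at most 2; the
  quadratic part alone makes both limsups infinite.\<close>

lemma mixed_quadratic_spikes_limits:
  "cesaro_liminf mixed_quadratic_spikes < abel_liminf mixed_quadratic_spikes"
  "abel_liminf mixed_quadratic_spikes < \<infinity>"
  "abel_limsup mixed_quadratic_spikes = \<infinity>"
  "cesaro_limsup mixed_quadratic_spikes = \<infinity>"
proof -
  note c_def = mixed_quadratic_spikes_def[abs_def]
  note lims = dyadic_plus_sparse_liminfs[OF quadratic_spikes_nonneg summable_quadratic_spikes
      cesaro_mean_quadratic_spikes_le abel_mean_quadratic_spikes_le, of 1, folded c_def, OF _ _ zero_le_one]
  show "cesaro_liminf mixed_quadratic_spikes < abel_liminf mixed_quadratic_spikes"
    using lims(1,2) by (auto intro: le_less_trans)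
  show "abel_liminf mixed_quadratic_spikes < \<infinity>"
    using lims(3) by auto
  have "\<infinity> \<le> abel_limsup mixed_quadratic_spikes"
  proof (rule le_abel_limsup[OF tendsto_sparse_infinity])
    fix k
    let ?\<alpha> = "1 - 1 / real (sparse_time k)"
    have \<alpha>: "0 < ?\<alpha>" "?\<alpha> < 1" using one_minus_inverse_sparse[of 1 k] by auto
    have "0 \<le> abel_mean dyadic_spikes ?\<alpha>"
      using \<alpha> by (intro abel_mean_nonneg dyadic_spikes_nonneg summable_dyadic_spikes) auto
    moreover have "abel_mean mixed_quadratic_spikes ?\<alpha>
        = abel_mean dyadic_spikes ?\<alpha> + 1 * abel_mean quadratic_spikes ?\<alpha>"
      unfolding c_def using \<alpha>
      by (intro abel_mean_add_mult summable_dyadic_spikes summable_quadratic_spikes)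
    ultimately show "ereal (real (sparse_time k) / 4) \<le> ereal (abel_mean mixed_quadratic_spikes ?\<alpha>)"
      using abel_mean_quadratic_spikes_ge[of k] by simp
  qed
  then show "abel_limsup mixed_quadratic_spikes = \<infinity>" by simp
  have "\<infinity> \<le> cesaro_limsup mixed_quadratic_spikes"
  proof (rule le_cesaro_limsup[OF tendsto_sparse_infinity])
    fix k
    have "0 \<le> cesaro_mean dyadic_spikes (sparse_time k + 1)"
      by (rule cesaro_mean_nonneg[OF dyadic_spikes_nonneg])
    then show "ereal (real (sparse_time k) / 4)
        \<le> ereal (cesaro_mean mixed_quadratic_spikes (sparse_time k + 1))"
      unfolding c_def cesaro_mean_add_mult using cesaro_mean_quadratic_spikes_ge[of k] by simp
  qed
  then show "cesaro_limsup mixed_quadratic_spikes = \<infinity>" by simp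
qed

section \<open>Assembly of the four patterns\<close>

lemma summable_add_mult:
  fixes c d :: "nat \<Rightarrow> real"
  assumes "summable (\<lambda>n. \<alpha> ^ n * c n)" "summable (\<lambda>n. \<alpha> ^ n * d n)"
  shows "summable (\<lambda>n. \<alpha> ^ n * (c n + k * d n))"
  using summable_add[OF assms(1) summable_mult[OF assms(2), of k]] by (simp add: algebra_simps)

theorem mainTheorem4:
  shows
    "(\<forall>R \<in> {\<lambda>Cl Al Au Cu. Cl < Al \<and> Al < Au \<and> Au < Cu,
            \<lambda>Cl Al Au Cu. Cl = Al \<and> Al < Au \<and> Au = Cu,
            \<lambda>Cl Al Au Cu. Cl < Al \<and> Al < Au \<and> Au = Cu,
            \<lambda>Cl Al Au Cu. Cl = Al \<and> Al < Au \<and> Au < (Cu :: ereal)}.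
        \<exists>(M :: (nat, nat) mdp) x \<phi>.
          is_mdp M \<and> infinite (states M) \<and> x \<in> states M \<and> stationary M \<phi> \<and>
          R (cesaro_lower M x \<phi>) (abel_lower M x \<phi>) (abel_upper M x \<phi>) (cesaro_upper M x \<phi>) \<and>
          R (optimal_value cesaro_lower M x) (optimal_value abel_lower M x)
            (optimal_value abel_upper M x) (optimal_value cesaro_upper M x)) \<and>
     \<not> (\<forall>(M :: (nat, nat) mdp) x.
          is_mdp M \<and> infinite (states M) \<and> x \<in> states M \<and>
          optimal_value cesaro_upper M x = optimal_value abel_upper M x \<longrightarrow>
          optimal_value cesaro_lower M x = optimal_value abel_lower M x) \<and>
     \<not> (\<forall>(M :: (nat, nat) mdp) x.
          is_mdp M \<and> infinite (states M) \<and> x \<in> states M \<and>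
          optimal_value cesaro_lower M x = optimal_value abel_lower M x \<longrightarrow>
          optimal_value cesaro_upper M x = optimal_value abel_upper M x)"
proof -
  let ?ex = "\<lambda>R. \<exists>(M :: (nat, nat) mdp) x \<phi>.
          is_mdp M \<and> infinite (states M) \<and> x \<in> states M \<and> stationary M \<phi> \<and>
          R (cesaro_lower M x \<phi>) (abel_lower M x \<phi>) (abel_upper M x \<phi>) (cesaro_upper M x \<phi>) \<and>
          R (optimal_value cesaro_lower M x) (optimal_value abel_lower M x)
            (optimal_value abel_upper M x) (optimal_value cesaro_upper M x)"
  have 1: "?ex (\<lambda>Cl Al Au Cu. Cl < Al \<and> Al < Au \<and> Au < Cu)"
  proof (rule ex_mdp_of_cost_sequence[where c = mixed_linear_spikes])
    show "0 \<le> mixed_linear_spikes n" for n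
      by (simp add: mixed_linear_spikes_def spikes_def)
    show "summable (\<lambda>n. \<alpha> ^ n * mixed_linear_spikes n)" if "0 < \<alpha>" "\<alpha> < 1" for \<alpha>
      unfolding mixed_linear_spikes_def
      using that by (intro summable_add_mult summable_dyadic_spikes summable_linear_spikes)
  qed (use mixed_linear_spikes_limits in blast)
  have 2: "?ex (\<lambda>Cl Al Au Cu. Cl = Al \<and> Al < Au \<and> Au = Cu)"
    by (rule ex_mdp_of_cost_sequence[where c = quadratic_spikes])
       (simp_all add: quadratic_spikes_nonneg summable_quadratic_spikes quadratic_spikes_limits)
  have 3: "?ex (\<lambda>Cl Al Au Cu. Cl < Al \<and> Al < Au \<and> Au = Cu)"
  proof (rule ex_mdp_of_cost_sequence[where c = mixed_quadratic_spikes])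
    show "0 \<le> mixed_quadratic_spikes n" for n
      by (simp add: mixed_quadratic_spikes_def spikes_def)
    show "summable (\<lambda>n. \<alpha> ^ n * mixed_quadratic_spikes n)" if "0 < \<alpha>" "\<alpha> < 1" for \<alpha>
      unfolding mixed_quadratic_spikes_def
      using that by (intro summable_add_mult summable_dyadic_spikes summable_quadratic_spikes)
  qed (use mixed_quadratic_spikes_limits in simp)
  have 4: "?ex (\<lambda>Cl Al Au Cu. Cl = Al \<and> Al < Au \<and> Au < Cu)"
  proof (rule ex_mdp_of_cost_sequence[where c = linear_spikes])
    have "0 < abel_limsup linear_spikes"
      by (rule less_le_trans[OF _ linear_spikes_limits(3)]) simp
    moreover have "abel_limsup linear_spikes < cesaro_limsup linear_spikes"
      by (rule le_less_trans[OF linear_spikes_limits(4) less_le_trans[OF _ linear_spikes_limits(5)]]) simp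
    ultimately show "cesaro_liminf linear_spikes = abel_liminf linear_spikes
        \<and> abel_liminf linear_spikes < abel_limsup linear_spikes
        \<and> abel_limsup linear_spikes < cesaro_limsup linear_spikes"
      by (simp add: linear_spikes_limits(1,2))
  qed (simp_all add: linear_spikes_nonneg summable_linear_spikes)
  show ?thesis
  proof (intro conjI)
    show "\<forall>R \<in> {\<lambda>Cl Al Au Cu. Cl < Al \<and> Al < Au \<and> Au < Cu,
            \<lambda>Cl Al Au Cu. Cl = Al \<and> Al < Au \<and> Au = Cu,
            \<lambda>Cl Al Au Cu. Cl < Al \<and> Al < Au \<and> Au = Cu,
            \<lambda>Cl Al Au Cu. Cl = Al \<and> Al < Au \<and> Au < (Cu :: ereal)}. ?ex R"
      by (intro ballI, elim insertE emptyE; hypsubst; rule 1 2 3 4)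
    show "\<not> (\<forall>(M :: (nat, nat) mdp) x.
          is_mdp M \<and> infinite (states M) \<and> x \<in> states M \<and>
          optimal_value cesaro_upper M x = optimal_value abel_upper M x \<longrightarrow>
          optimal_value cesaro_lower M x = optimal_value abel_lower M x)"
      \<comment> \<open>In pattern (3) the upper values agree and the lower ones differ; pattern (4)
        below is the reverse.\<close>
      using 3 by (metis less_irrefl)
    show "\<not> (\<forall>(M :: (nat, nat) mdp) x.
          is_mdp M \<and> infinite (states M) \<and> x \<in> states M \<and>
          optimal_value cesaro_lower M x = optimal_value abel_lower M x \<longrightarrow>
          optimal_value cesaro_upper M x = optimal_value abel_upper M x)"
      using 4 by (metis less_irrefl)
  qed
qed

end
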